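(* Let $G$ be a locally compact group, let $\tau:G\to\mathbb{C}^{\times}$ be a measurable sub-multiplicative function, and let $n\in\mathbb{N}$. Then $L^1(G)_{\tau(n)}$ is a Banach algebra with the convolution product and the norm $\|\cdot\|_{\tau(n)}$.
   Context: $L^1(G)$ is the group algebra with respect to left Haar measure, with norm $\|f\|_1=\int_G|f(x)|\,dx$ and convolution $f*g(x)=\int_G f(y)g(y^{-1}x)\,dy$. $\mathbb{C}^{\times}$ denotes the non-zero complex numbers. A function $\tau:G\to\mathbb{C}^\times$ is sub-multiplicative if $|\tau(xy)|\le|\tau(x)||\tau(y)|$ for all $x,y\in G$. Define $L^1(G)_{\tau(n)}=\{f\in L^1(G): f\tau,\dots,f\tau^n\in L^1(G)\}$ (pointwise products and powers) and $\|f\|_{\tau(n)}=\sum_{k=0}^n\|f\tau^k\|_1$. *)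

theory Defs
  imports "HOL-Analysis.Analysis"
begin

text \<open>
  The group \<open>G\<close> is a type of class \<open>topological_group_add\<close>. This class does not require
  commutativity; only the notation is additive: \<open>x + y\<close> stands for the product \<open>xy\<close>,
  \<open>- x\<close> for the inverse of \<open>x\<close> and \<open>0\<close> for the identity. Locally compact groups are Hausdorff.
\<close>

definition left_haar_measure :: "'a::{topological_group_add, t2_space} measure \<Rightarrow> bool" where
  "left_haar_measure M \<longleftrightarrow>
     sets M = sets borel \<and>
     (\<forall>K. compact K \<longrightarrow> emeasure M K < \<infinity>) \<and>
     (\<forall>A\<in>sets borel. emeasure M A = (INF U\<in>{U. open U \<and> A \<subseteq> U}. emeasure M U)) \<and>
     (\<forall>U. open U \<longrightarrow> emeasure M U = (SUP K\<in>{K. compact K \<and> K \<subseteq> U}. emeasure M K)) \<and>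
     (\<forall>a. \<forall>A\<in>sets borel. emeasure M ((\<lambda>x. a + x) ` A) = emeasure M A) \<and>
     emeasure M UNIV \<noteq> 0"

definition submultiplicative :: "('a::group_add \<Rightarrow> complex) \<Rightarrow> bool" where
  "submultiplicative \<tau> \<longleftrightarrow> (\<forall>x y. norm (\<tau> (x + y)) \<le> norm (\<tau> x) * norm (\<tau> y))"

text \<open>Elements of \<open>L1 M\<close> are classes of integrable functions modulo equality almost everywhere.\<close>

definition ae_eq :: "'a measure \<Rightarrow> (('a \<Rightarrow> complex) \<times> ('a \<Rightarrow> complex)) set" where
  "ae_eq M = {(f, g). integrable M f \<and> integrable M g \<and> (AE x in M. f x = g x)}"

definition L1 :: "'a measure \<Rightarrow> ('a \<Rightarrow> complex) set set" where
  "L1 M = {f. integrable M f} // ae_eq M"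

definition L1_zero :: "'a measure \<Rightarrow> ('a \<Rightarrow> complex) set" where
  "L1_zero M = ae_eq M `` {\<lambda>x. 0}"

definition L1_add :: "'a measure \<Rightarrow> ('a \<Rightarrow> complex) set \<Rightarrow> ('a \<Rightarrow> complex) set \<Rightarrow> ('a \<Rightarrow> complex) set"
  where "L1_add M F G = (\<Union>f\<in>F. \<Union>g\<in>G. ae_eq M `` {\<lambda>x. f x + g x})"

definition L1_scale :: "'a measure \<Rightarrow> complex \<Rightarrow> ('a \<Rightarrow> complex) set \<Rightarrow> ('a \<Rightarrow> complex) set"
  where "L1_scale M c F = (\<Union>f\<in>F. ae_eq M `` {\<lambda>x. c * f x})"

text \<open>
  \<open>h = f * g\<close> in \<open>L1\<close>: for almost every \<open>x\<close> the integral defining \<open>(f * g)(x)\<close>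
  exists and its value is \<open>h x\<close>. Stating existence through \<open>has_bochner_integral\<close> avoids
  the default value \<open>0\<close> that \<open>lebesgue_integral\<close> takes on non-integrable functions.
\<close>

definition is_convolution ::
  "'a::group_add measure \<Rightarrow> ('a \<Rightarrow> complex) \<Rightarrow> ('a \<Rightarrow> complex) \<Rightarrow> ('a \<Rightarrow> complex) \<Rightarrow> bool" where
  "is_convolution M f g h \<longleftrightarrow>
     (AE x in M. has_bochner_integral M (\<lambda>y. f y * g (- y + x)) (h x))"

definition L1_convolution ::
  "'a::group_add measure \<Rightarrow> ('a \<Rightarrow> complex) set \<Rightarrow> ('a \<Rightarrow> complex) set \<Rightarrow> ('a \<Rightarrow> complex) set" where
  "L1_convolution M F G = {h. integrable M h \<and> (\<exists>f\<in>F. \<exists>g\<in>G. is_convolution M f g h)}"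

definition L1_tau :: "'a measure \<Rightarrow> ('a \<Rightarrow> complex) \<Rightarrow> nat \<Rightarrow> ('a \<Rightarrow> complex) set set" where
  "L1_tau M \<tau> n = {F \<in> L1 M. \<forall>f\<in>F. \<forall>k\<in>{1..n}. integrable M (\<lambda>x. f x * \<tau> x ^ k)}"

text \<open>The norm does not depend on the representative, so the image below is a singleton.\<close>

definition norm_tau :: "'a measure \<Rightarrow> ('a \<Rightarrow> complex) \<Rightarrow> nat \<Rightarrow> ('a \<Rightarrow> complex) set \<Rightarrow> real" where
  "norm_tau M \<tau> n F =
     the_elem ((\<lambda>f. \<Sum>k\<le>n. LINT x|M. norm (f x * \<tau> x ^ k)) ` F)"

text \<open>
  A complex Banach algebra on a carrier set, not necessarily unital. The difference
  \<open>x - y\<close> is written \<open>add x (scale (- 1) y)\<close>.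
\<close>

locale complex_banach_algebra_on =
  fixes A :: "'b set"
    and zero :: 'b
    and add :: "'b \<Rightarrow> 'b \<Rightarrow> 'b"
    and scale :: "complex \<Rightarrow> 'b \<Rightarrow> 'b"
    and mult :: "'b \<Rightarrow> 'b \<Rightarrow> 'b"
    and nrm :: "'b \<Rightarrow> real"
  assumes zero_closed: "zero \<in> A"
    and add_closed: "\<lbrakk>x \<in> A; y \<in> A\<rbrakk> \<Longrightarrow> add x y \<in> A"
    and scale_closed: "x \<in> A \<Longrightarrow> scale c x \<in> A"
    and mult_closed: "\<lbrakk>x \<in> A; y \<in> A\<rbrakk> \<Longrightarrow> mult x y \<in> A"
    and add_assoc: "\<lbrakk>x \<in> A; y \<in> A; z \<in> A\<rbrakk> \<Longrightarrow> add (add x y) z = add x (add y z)"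
    and add_commute: "\<lbrakk>x \<in> A; y \<in> A\<rbrakk> \<Longrightarrow> add x y = add y x"
    and add_zero: "x \<in> A \<Longrightarrow> add zero x = x"
    and add_inverse: "x \<in> A \<Longrightarrow> \<exists>y\<in>A. add x y = zero"
    and scale_add_right: "\<lbrakk>x \<in> A; y \<in> A\<rbrakk> \<Longrightarrow> scale c (add x y) = add (scale c x) (scale c y)"
    and scale_add_left: "x \<in> A \<Longrightarrow> scale (c + d) x = add (scale c x) (scale d x)"
    and scale_scale: "x \<in> A \<Longrightarrow> scale c (scale d x) = scale (c * d) x"
    and scale_one: "x \<in> A \<Longrightarrow> scale 1 x = x"
    and mult_assoc: "\<lbrakk>x \<in> A; y \<in> A; z \<in> A\<rbrakk> \<Longrightarrow> mult (mult x y) z = mult x (mult y z)"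
    and mult_add_left: "\<lbrakk>x \<in> A; y \<in> A; z \<in> A\<rbrakk> \<Longrightarrow> mult (add x y) z = add (mult x z) (mult y z)"
    and mult_add_right: "\<lbrakk>x \<in> A; y \<in> A; z \<in> A\<rbrakk> \<Longrightarrow> mult x (add y z) = add (mult x y) (mult x z)"
    and mult_scale_left: "\<lbrakk>x \<in> A; y \<in> A\<rbrakk> \<Longrightarrow> mult (scale c x) y = scale c (mult x y)"
    and mult_scale_right: "\<lbrakk>x \<in> A; y \<in> A\<rbrakk> \<Longrightarrow> mult x (scale c y) = scale c (mult x y)"
    and norm_nonneg: "x \<in> A \<Longrightarrow> 0 \<le> nrm x"
    and norm_eq_zero: "x \<in> A \<Longrightarrow> nrm x = 0 \<longleftrightarrow> x = zero"
    and norm_scale: "x \<in> A \<Longrightarrow> nrm (scale c x) = norm c * nrm x"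
    and norm_triangle: "\<lbrakk>x \<in> A; y \<in> A\<rbrakk> \<Longrightarrow> nrm (add x y) \<le> nrm x + nrm y"
    and norm_mult: "\<lbrakk>x \<in> A; y \<in> A\<rbrakk> \<Longrightarrow> nrm (mult x y) \<le> nrm x * nrm y"
    and complete: "\<lbrakk>\<And>i. X i \<in> A;
        \<And>e. 0 < e \<Longrightarrow> \<exists>N. \<forall>i\<ge>N. \<forall>j\<ge>N. nrm (add (X i) (scale (- 1) (X j))) < e\<rbrakk>
      \<Longrightarrow> \<exists>x\<in>A. (\<lambda>i. nrm (add (X i) (scale (- 1) x))) \<longlonglongrightarrow> 0"

end

theory Submission
  imports Defs
begin

text \<open>
  The group need be neither second countable nor \<open>\<sigma>\<close>-compact, so \<open>M\<close> may fail to be \<open>\<sigma>\<close>-finite and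
  \<open>(y, x) \<mapsto> g (- y + x)\<close> may fail to be \<open>borel \<Otimes>\<^sub>M borel\<close>-measurable for Borel \<open>g\<close>. Both obstacles
  disappear after changing an integrable function on a null set: by regularity and Urysohn's lemma it
  is almost everywhere a limit of continuous functions with compact support, which vanishes off a
  \<open>\<sigma>\<close>-compact set and has a measurable convolution kernel. Changing representatives is harmless because
  the reflection of a null set meets every \<open>\<sigma>\<close>-compact set in a null set. Fubini's theorem then gives
  the convolution algebra \<open>L\<^sup>1\<close>, the pointwise bound
  \<open>\<bar>f * g\<bar> \<bar>\<tau>\<bar>\<^sup>k \<le> \<bar>f \<tau>\<^sup>k\<bar> * \<bar>g \<tau>\<^sup>k\<bar>\<close> gives the norm inequality, and completeness follows from Fatou's lemma.
\<close>

subsection \<open>Products of \<open>\<sigma>\<close>-compact sets\<close>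

text \<open>The delicate point is the reflection \<open>x \<mapsto> - x\<close>, on which left
  invariance says nothing. No modular function is constructed: integrating \<phi>(- y + x) over a
  product of compact sets in both orders compares the integral of the reflected \<phi> with that of
  \<phi>, up to the measures of two compact sets, one of them positive and the other finite. This
  sends null sets to null sets only inside compact sets, which suffices because the left factor of a
  convolution vanishes almost everywhere off a \<sigma>-compact set. If the factors live on
  \<open>S\<close> and \<open>T\<close>, the integrand lives on the product of \<open>S\<close> with
  the set of sums of \<open>S\<close> and \<open>T\<close>, again \<sigma>-compact, so the
  \<sigma>-finite theory applies there. The weight enters only through the two integrable functions
  \<bar>f \<tau>^k\<bar> and \<bar>g \<tau>^k\<bar>: the majorant is their convolution, so the
  question whether \<tau> is measurable on the product never arises.\<close>

definition sigma_compact :: "'a::topological_space set \<Rightarrow> bool" where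
  "sigma_compact S \<longleftrightarrow> (\<exists>K::nat \<Rightarrow> 'a set. (\<forall>i. compact (K i)) \<and> S = (\<Union>i. K i))"

lemma sigma_compact_compact: "compact K \<Longrightarrow> sigma_compact K"
  unfolding sigma_compact_def by (rule exI[of _ "\<lambda>_. K"]) auto

lemma sigma_compact_countable_UN:
  assumes "countable I" "\<And>i. i \<in> I \<Longrightarrow> compact (K i)"
  shows "sigma_compact (\<Union>i\<in>I. K i)"
proof (cases "I = {}")
  case True
  then show ?thesis using sigma_compact_compact[of "{}"] by simp
next
  case False
  then have r: "range (from_nat_into I) = I"
    using assms(1) by (simp add: range_from_nat_into)
  show ?thesis
    unfolding sigma_compact_def
  proof (intro exI conjI allI)
    show "compact (K (from_nat_into I i))" for i
      using False by (intro assms(2) from_nat_into)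
    show "(\<Union>i\<in>I. K i) = (\<Union>i. K (from_nat_into I i))"
      using r by (metis image_image)
  qed
qed

text \<open>Controls the support of a convolution: if \<open>f y * g (- y + x)\<close> is nonzero,
  then \<open>x = y + (- y + x)\<close> is a sum of points of the two supports.\<close>

lemma sigma_compact_add:
  fixes S T :: "'a::topological_monoid_add set"
  assumes "sigma_compact S" "sigma_compact T"
  shows "sigma_compact {x + y |x y. x \<in> S \<and> y \<in> T}"
proof -
  obtain K L where K: "\<And>i::nat. compact (K i)" "S = (\<Union>i. K i)"
    and L: "\<And>i::nat. compact (L i)" "T = (\<Union>i. L i)"
    using assms unfolding sigma_compact_def by metis
  have "{x + y |x y. x \<in> S \<and> y \<in> T} = (\<Union>p\<in>UNIV. (\<lambda>(x, y). x + y) ` (K (fst p) \<times> L (snd p)))"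
    unfolding K(2) L(2) by force
  also have "sigma_compact \<dots>"
  proof (rule sigma_compact_countable_UN)
    show "compact ((\<lambda>(x, y). x + y) ` (K (fst p) \<times> L (snd p)))" for p :: "nat \<times> nat"
      unfolding split_beta
      by (intro compact_continuous_image compact_Times K L continuous_intros)
  qed auto
  finally show ?thesis .
qed

lemma borel_sigma_compact: "sigma_compact S \<Longrightarrow> S \<in> sets (borel :: 'a::t2_space measure)"
  unfolding sigma_compact_def by (elim exE conjE, hypsubst, intro sets.countable_UN'' borel_compact) auto

text \<open>
  \<open>borel \<Otimes>\<^sub>M borel\<close> may miss open subsets of the product, as \<open>'a\<close> and \<open>'b\<close> need not be second
  countable. Inside a \<open>\<sigma>\<close>-compact rectangle finitely many open boxes suffice for each compact
  superlevel set.
\<close>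

lemma sets_pair_superlevel:
  fixes F :: "'a::t2_space \<times> 'b::t2_space \<Rightarrow> real"
  assumes F: "continuous_on UNIV F" and "sigma_compact S" "sigma_compact T"
  shows "{p \<in> S \<times> T. a < F p} \<in> sets (borel \<Otimes>\<^sub>M borel)"
proof -
  obtain K L where K: "\<And>i::nat. compact (K i)" "S = (\<Union>i. K i)"
    and L: "\<And>i::nat. compact (L i)" "T = (\<Union>i. L i)"
    using assms unfolding sigma_compact_def by metis
  define W where "W = {p. a < F p}"
  have "open W"
    unfolding W_def by (intro open_Collect_less continuous_intros F)
  define C where "C i j n = (K i \<times> L j) \<inter> {p. a + 1 / real (Suc n) \<le> F p}" for i j n
  have cC: "compact (C i j n)" for i j n
    unfolding C_def
    by (intro compact_Int_closed compact_Times K L closed_Collect_le continuous_intros F)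
  have CW: "C i j n \<subseteq> W" for i j n
  proof
    fix p assume "p \<in> C i j n"
    moreover have "a < a + 1 / real (Suc n)" by simp
    ultimately show "p \<in> W"
      unfolding C_def W_def by (simp only: Int_iff mem_Collect_eq) linarith
  qed
  have "\<exists>B. B \<in> sets (borel \<Otimes>\<^sub>M borel) \<and> C i j n \<subseteq> B \<and> B \<subseteq> W" for i j n
  proof -
    have "\<exists>U V. open U \<and> open V \<and> p \<in> U \<times> V \<and> U \<times> V \<subseteq> W" if "p \<in> C i j n" for p
    proof -
      have "p \<in> W" using that CW by (rule set_mp[rotated])
      with \<open>open W\<close> show ?thesis using open_prod_elim[of W p] by metis
    qed
    then obtain U V where UV: "\<And>p. p \<in> C i j n \<Longrightarrow> open (U p) \<and> open (V p) \<and> p \<in> U p \<times> V p \<and> U p \<times> V p \<subseteq> W"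
      by metis
    obtain I where I: "I \<subseteq> C i j n" "finite I" "C i j n \<subseteq> (\<Union>p\<in>I. U p \<times> V p)"
    proof (rule compactE_image[OF cC, of "C i j n" "\<lambda>p. U p \<times> V p"])
      show "open (U p \<times> V p)" if "p \<in> C i j n" for p
        using UV[OF that] by (auto intro: open_Times)
      show "C i j n \<subseteq> (\<Union>p\<in>C i j n. U p \<times> V p)"
        using UV by blast
    qed auto
    show ?thesis
    proof (intro exI conjI)
      show "(\<Union>p\<in>I. U p \<times> V p) \<in> sets (borel \<Otimes>\<^sub>M borel)"
        using I UV by (intro sets.finite_UN pair_measureI borel_open) auto
      show "(\<Union>p\<in>I. U p \<times> V p) \<subseteq> W"
        using I UV by blast
    qed (rule I)
  qed
  then obtain B where B: "\<And>i j n. B i j n \<in> sets (borel \<Otimes>\<^sub>M borel) \<and> C i j n \<subseteq> B i j n \<and> B i j n \<subseteq> W"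
    by metis
  \<comment> \<open>\<open>B i j n\<close> may leave the rectangle but not \<open>W\<close>, so
    cutting the union back to \<open>S \<times> T\<close> gives the set exactly.\<close>
  have "{p \<in> S \<times> T. a < F p} = (\<Union>i j n. B i j n) \<inter> (S \<times> T)"
  proof
    show "{p \<in> S \<times> T. a < F p} \<subseteq> (\<Union>i j n. B i j n) \<inter> (S \<times> T)"
    proof safe
      fix x y assume xy: "x \<in> S" "y \<in> T" and a: "a < F (x, y)"
      obtain i j where "x \<in> K i" "y \<in> L j"
        using xy K(2) L(2) by blast
      moreover obtain n where "1 / real (Suc n) < F (x, y) - a"
        using a nat_approx_posE[of "F (x, y) - a"] by auto
      ultimately have "(x, y) \<in> C i j n"
        by (auto simp: C_def)
      then show "(x, y) \<in> (\<Union>i j n. B i j n)"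
        using B[of i j n] by (meson UN_I UNIV_I subsetD)
    qed
    show "(\<Union>i j n. B i j n) \<inter> (S \<times> T) \<subseteq> {p \<in> S \<times> T. a < F p}"
    proof -
      have "(\<Union>i j n. B i j n) \<subseteq> W"
        using B by (intro UN_least) simp
      then show ?thesis unfolding W_def by auto
    qed
  qed
  also have "\<dots> \<in> sets (borel \<Otimes>\<^sub>M borel)"
    using B by (intro sets.Int sets.countable_UN'' pair_measureI borel_sigma_compact assms) auto
  finally show ?thesis .
qed

lemma borel_measurable_pair_continuous_real:
  fixes F :: "'a::t2_space \<times> 'b::t2_space \<Rightarrow> real"
  assumes F: "continuous_on UNIV F" and S: "sigma_compact S" and T: "sigma_compact T"
  shows "(\<lambda>p. indicator (S \<times> T) p * F p) \<in> borel_measurable (borel \<Otimes>\<^sub>M borel)"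
  unfolding borel_measurable_iff_greater
proof
  fix a :: real
  have ST: "S \<times> T \<in> sets (borel \<Otimes>\<^sub>M borel)"
    by (intro pair_measureI borel_sigma_compact S T)
  \<comment> \<open>Off the rectangle the product is 0, which exceeds \<open>a\<close> exactly when
    \<open>a < 0\<close>.\<close>
  have eq: "{p \<in> space (borel \<Otimes>\<^sub>M borel). a < indicator (S \<times> T) p * F p} =
      {p \<in> S \<times> T. a < F p} \<union> (if a < 0 then space (borel \<Otimes>\<^sub>M borel) - S \<times> T else {})"
    by (auto simp: space_pair_measure indicator_def split: if_splits)
  show "{p \<in> space (borel \<Otimes>\<^sub>M borel). a < indicator (S \<times> T) p * F p} \<in> sets (borel \<Otimes>\<^sub>M borel)"
    unfolding eq by (cases "a < 0") (use sets_pair_superlevel[OF assms] ST in \<open>simp_all only: if_True if_False Un_empty_right sets.Un sets.compl_sets\<close>)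
qed

lemma borel_measurable_pair_continuous:
  fixes F :: "'a::t2_space \<times> 'b::t2_space \<Rightarrow> complex"
  assumes F: "continuous_on UNIV F" and S: "sigma_compact S" and T: "sigma_compact T"
  shows "(\<lambda>p. indicator (S \<times> T) p * F p) \<in> borel_measurable (borel \<Otimes>\<^sub>M borel)"
proof (rule borel_measurable_complex_iff[THEN iffD2], intro conjI)
  have *: "Re (indicator (S \<times> T) p * F p) = indicator (S \<times> T) p * Re (F p)"
    "Im (indicator (S \<times> T) p * F p) = indicator (S \<times> T) p * Im (F p)" for p
    by (auto simp: indicator_def)
  show "(\<lambda>p. Re (indicator (S \<times> T) p * F p)) \<in> borel_measurable (borel \<Otimes>\<^sub>M borel)"
    "(\<lambda>p. Im (indicator (S \<times> T) p * F p)) \<in> borel_measurable (borel \<Otimes>\<^sub>M borel)"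
    unfolding * by (intro borel_measurable_pair_continuous_real S T continuous_intros F)+
qed

subsection \<open>Haar measure\<close>

locale haar_group =
  fixes M :: "'a::{topological_group_add, t2_space} measure"
  assumes locally_compact: "locally_compact_space (euclidean :: 'a topology)"
    and haar: "left_haar_measure M"
begin

lemmas haar_conjs = haar[unfolded left_haar_measure_def]
lemmas haar_compact = haar_conjs[THEN conjunct2, THEN conjunct1, rule_format]
lemmas haar_outer = haar_conjs[THEN conjunct2, THEN conjunct2, THEN conjunct1, rule_format]
lemmas haar_inner = haar_conjs[THEN conjunct2, THEN conjunct2, THEN conjunct2, THEN conjunct1, rule_format]
lemmas haar_invariant = haar_conjs[THEN conjunct2, THEN conjunct2, THEN conjunct2, THEN conjunct2, THEN conjunct1, rule_format]
lemmas haar_nonzero = haar_conjs[THEN conjunct2, THEN conjunct2, THEN conjunct2, THEN conjunct2, THEN conjunct2]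

lemma sets_M [measurable_cong, simp]: "sets M = sets borel"
  by (rule haar_conjs[THEN conjunct1])

lemma space_M [simp]: "space M = UNIV"
  using sets_eq_imp_space_eq[OF sets_M] by simp

lemma borel_measurable_M [simp]: "borel_measurable M = borel_measurable borel"
  by (rule measurable_cong_sets) auto

lemma emeasure_compact: "compact K \<Longrightarrow> emeasure M K < \<infinity>"
  by (rule haar_compact)

lemma emeasure_translate: "A \<in> sets borel \<Longrightarrow> emeasure M ((\<lambda>x. a + x) ` A) = emeasure M A"
  by (rule haar_invariant)

lemma outer_regular:
  assumes "A \<in> sets borel" "emeasure M A < c"
  obtains U where "open U" "A \<subseteq> U" "emeasure M U < c"
proof -
  have "(INF U\<in>{U. open U \<and> A \<subseteq> U}. emeasure M U) < c"
    using assms by (simp only: haar_outer)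
  then show thesis using that by (auto simp: INF_less_iff)
qed

lemma inner_regular:
  assumes "open U" "c < emeasure M U"
  obtains K where "compact K" "K \<subseteq> U" "c < emeasure M K"
proof -
  have "c < (SUP K\<in>{K. compact K \<and> K \<subseteq> U}. emeasure M K)"
    using assms by (simp only: haar_inner)
  then show thesis using that by (auto simp: less_SUP_iff)
qed

section \<open>Left translation of integrals and of almost everywhere statements\<close>

lemma measurable_translate [measurable]: "(\<lambda>x::'a. a + x) \<in> measurable borel borel"
  by (intro borel_measurable_continuous_onI continuous_intros)

lemma measurable_uminus_group [measurable]: "(\<lambda>x::'a. - x) \<in> measurable borel borel"
  by (intro borel_measurable_continuous_onI continuous_intros)

lemma measurable_flip [measurable]: "(\<lambda>y::'a. - y + x) \<in> measurable borel borel"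
  by (intro borel_measurable_continuous_onI continuous_intros)

text \<open>Invariance is given for images of sets. As an identity of push-forwards it yields the
  translation rules for integrals and null sets.\<close>

lemma distr_translate: "distr M M (\<lambda>x. a + x) = M"
proof (rule measure_eqI)
  fix A assume "A \<in> sets (distr M M (\<lambda>x. a + x))"
  then have A: "A \<in> sets borel" by simp
  have "(\<lambda>x. a + x) -` A = (\<lambda>x. - a + x) ` A"
    by (force simp: image_iff add.assoc[symmetric])
  then have "emeasure (distr M M (\<lambda>x. a + x)) A = emeasure M ((\<lambda>x. - a + x) ` A)"
    using A by (subst emeasure_distr) auto
  also have "\<dots> = emeasure M A"
    using A by (rule emeasure_translate)
  finally show "emeasure (distr M M (\<lambda>x. a + x)) A = emeasure M A" .
qed simp

lemma nn_integral_translate: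
  "f \<in> borel_measurable borel \<Longrightarrow> (\<integral>\<^sup>+x. f (a + x) \<partial>M) = (\<integral>\<^sup>+x. f x \<partial>M)"
  using nn_integral_distr[of "\<lambda>x. a + x" M M f] by (simp add: distr_translate)

lemma integrable_translate:
  fixes f :: "'a \<Rightarrow> 'b::{banach, second_countable_topology}"
  shows "f \<in> borel_measurable borel \<Longrightarrow> integrable M (\<lambda>x. f (a + x)) \<longleftrightarrow> integrable M f"
  using integrable_distr_eq[of "\<lambda>x. a + x" M M f] by (simp add: distr_translate)

lemma integral_translate:
  fixes f :: "'a \<Rightarrow> 'b::{banach, second_countable_topology}"
  shows "f \<in> borel_measurable borel \<Longrightarrow> (LINT x|M. f (a + x)) = (LINT x|M. f x)"
  using integral_distr[of "\<lambda>x. a + x" M M f] by (simp add: distr_translate)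

lemma AE_translate:
  assumes "AE x in M. P x"
  shows "AE x in M. P (a + x)"
proof -
  have "AE x in distr M M (\<lambda>x. a + x). P x"
    unfolding distr_translate by (rule assms)
  then show ?thesis
    using AE_distrD[of "\<lambda>x. a + x" M M P] by simp
qed

text \<open>Encoded as a density and not as a subspace: the space and the \<sigma>-algebra stay
  those of \<open>M\<close>, so functions on the whole group are integrated against it unchanged.
  For \<sigma>-compact \<open>S\<close> it is \<sigma>-finite, as Tonelli and Fubini
  require.\<close>

definition M_on :: "'a set \<Rightarrow> 'a measure" where
  "M_on S = density M (\<lambda>x. ennreal (indicator S x))"

lemma sets_M_on [measurable_cong, simp]: "sets (M_on S) = sets borel"
  by (simp add: M_on_def)

lemma space_M_on [simp]: "space (M_on S) = UNIV"
  by (simp add: M_on_def)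

lemma sigma_finite_M_on:
  assumes "sigma_compact S"
  shows "sigma_finite_measure (M_on S)"
proof
  obtain K where K: "\<And>i::nat. compact (K i)" "S = (\<Union>i. K i)"
    using assms unfolding sigma_compact_def by metis
  have S: "S \<in> sets borel" by (rule borel_sigma_compact) fact
  have em: "emeasure (M_on S) A = emeasure M (A \<inter> S)" if "A \<in> sets borel" for A
    using that S
    by (simp add: M_on_def emeasure_density ennreal_indicator mult.commute
        flip: indicator_inter_arith)
  show "\<exists>A. countable A \<and> A \<subseteq> sets (M_on S) \<and> \<Union>A = space (M_on S) \<and> (\<forall>a\<in>A. emeasure (M_on S) a \<noteq> \<infinity>)"
  proof (intro exI conjI ballI)
    \<comment> \<open>\<open>- S\<close> is null for \<open>M_on S\<close>, and compact sets have
      finite Haar measure.\<close>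
    let ?A = "insert (- S) (range K)"
    show "countable ?A" "\<Union>?A = space (M_on S)"
      using K by auto
    show "?A \<subseteq> sets (M_on S)"
      using S K(1) borel_compact by (metis (no_types, lifting) borel_comp image_subset_iff insert_subset sets_M_on)
    fix a assume "a \<in> ?A"
    then consider "a = - S" | i where "a = K i" by auto
    then show "emeasure (M_on S) a \<noteq> \<infinity>"
    proof cases
      case 1
      then show ?thesis using S by (subst em) auto
    next
      case 2
      then have "a \<inter> S = K i" using K by auto
      then show ?thesis using 2 K emeasure_compact[of "K i"] borel_compact[of "K i"] by (subst em) auto
    qed
  qed
qed

lemma nn_integral_M_on:
  assumes "S \<in> sets borel" "f \<in> borel_measurable borel"
  shows "(\<integral>\<^sup>+x. f x \<partial>M_on S) = (\<integral>\<^sup>+x. indicator S x * f x \<partial>M)"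
  unfolding M_on_def using assms
  by (subst nn_integral_density) (auto simp: ennreal_indicator)

lemma AE_M_on:
  assumes "S \<in> sets borel"
  shows "(AE x in M_on S. P x) \<longleftrightarrow> (AE x in M. x \<in> S \<longrightarrow> P x)"
  unfolding M_on_def using assms by (subst AE_density) auto

subsection \<open>Approximation by continuous functions\<close>

text \<open>Finitely many open sets, each inside a compact set, cover \<open>K\<close>. Intersecting
  with \<open>W\<close> later forces Urysohn functions to have compact support.\<close>

lemma compact_neighbourhood:
  assumes "compact (K :: 'a set)"
  obtains W C where "open W" "compact C" "K \<subseteq> W" "W \<subseteq> C"
proof -
  have "\<exists>U C. open U \<and> compact C \<and> x \<in> U \<and> U \<subseteq> C" for x :: 'a
    using locally_compact by (simp add: locally_compact_space_def)
  then obtain U C where UC: "\<And>x::'a. open (U x) \<and> compact (C x) \<and> x \<in> U x \<and> U x \<subseteq> C x"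
    by metis
  obtain I where I: "I \<subseteq> K" "finite I" "K \<subseteq> (\<Union>x\<in>I. U x)"
    by (rule compactE_image[OF assms, of K U]) (use UC in auto)
  show thesis
  proof
    show "open (\<Union>x\<in>I. U x)" "compact (\<Union>x\<in>I. C x)" "(\<Union>x\<in>I. U x) \<subseteq> (\<Union>x\<in>I. C x)"
      using UC I by (auto intro!: open_UN compact_UN UN_mono)
  qed (rule I)
qed

text \<open>A locally compact Hausdorff space is completely regular, and complete regularity
  separates a compact set from a disjoint closed one.\<close>

lemma Urysohn_function:
  assumes K: "compact (K :: 'a set)" and U: "open U" and "K \<subseteq> U"
  obtains \<phi> :: "'a \<Rightarrow> real" where "continuous_on UNIV \<phi>" "\<And>x. 0 \<le> \<phi> x" "\<And>x. \<phi> x \<le> 1"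
    "\<And>x. x \<in> K \<Longrightarrow> \<phi> x = 1" "\<And>x. x \<notin> U \<Longrightarrow> \<phi> x = 0"
proof -
  have cr: "completely_regular_space (euclidean :: 'a topology)"
  proof (intro locally_compact_regular_imp_completely_regular_space disjI1 locally_compact)
    show "Hausdorff_space (euclidean :: 'a topology)"
      unfolding Hausdorff_space_def disjnt_def using hausdorff by (simp; metis)
  qed
  obtain \<phi> :: "'a \<Rightarrow> real" where \<phi>: "continuous_map euclidean (top_of_set {0..1}) \<phi>"
    "\<phi> ` (- U) \<subseteq> {0}" "\<phi> ` K \<subseteq> {1}"
    by (rule Urysohn_completely_regular_compact_closed[OF _ cr, of 0 1 K "- U"])
      (use K U \<open>K \<subseteq> U\<close> in \<open>auto simp: disjnt_def\<close>)
  show thesis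
  proof
    show "continuous_on UNIV \<phi>" "0 \<le> \<phi> x" "\<phi> x \<le> 1" for x
      using \<phi>(1) by (auto simp: continuous_map_in_subtopology)
  qed (use \<phi>(2,3) in auto)
qed

section \<open>Continuous functions with compact support and their density\<close>

definition Cc :: "('a \<Rightarrow> complex) \<Rightarrow> bool" where
  "Cc f \<longleftrightarrow> continuous_on UNIV f \<and> (\<exists>C. compact C \<and> (\<forall>x. x \<notin> C \<longrightarrow> f x = 0))"

lemma Cc_borel: "Cc f \<Longrightarrow> f \<in> borel_measurable borel"
  unfolding Cc_def by (auto intro: borel_measurable_continuous_onI)

lemma Cc_integrable:
  assumes "Cc f"
  shows "integrable M f"
proof -
  obtain C where f: "continuous_on UNIV f" and C: "compact C" "\<And>x. x \<notin> C \<Longrightarrow> f x = 0"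
    using assms unfolding Cc_def by metis
  have "bounded (f ` C)"
    using f C by (intro compact_imp_bounded compact_continuous_image) (auto intro: continuous_on_subset)
  then obtain B where B: "\<And>x. x \<in> C \<Longrightarrow> norm (f x) \<le> B"
    by (auto simp: bounded_iff)
  show ?thesis
    by (rule integrableI_bounded_set[of C _ _ B])
      (use C B emeasure_compact[OF C(1)] Cc_borel[OF assms] borel_compact[OF C(1)] in auto)
qed

lemma Cc_add:
  assumes "Cc f" "Cc g"
  shows "Cc (\<lambda>x. f x + g x)"
proof -
  obtain C D where "compact C" "\<forall>x. x \<notin> C \<longrightarrow> f x = 0" "compact D" "\<forall>x. x \<notin> D \<longrightarrow> g x = 0"
    using assms unfolding Cc_def by metis
  then have "compact (C \<union> D)" "\<forall>x. x \<notin> C \<union> D \<longrightarrow> f x + g x = 0"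
    by auto
  moreover have "continuous_on UNIV (\<lambda>x. f x + g x)"
    using assms unfolding Cc_def by (intro continuous_on_add) simp_all
  ultimately show ?thesis
    unfolding Cc_def by metis
qed

text \<open>Inner regularity is given for open sets, so the compact set \<open>K\<close>
  approximates the outer neighbourhood \<open>U\<close> and may leave \<open>A\<close>. A function
  with values in [0, 1] that is 1 on \<open>K\<close> and 0 off \<open>U\<close> differs from the
  indicator of \<open>A\<close> by at most 1, and only on
  \<open>(U - A) \<union> (U - K)\<close>.\<close>

lemma Cc_approx_indicator:
  assumes A: "A \<in> sets borel" and fin: "emeasure M A < \<infinity>" and e: "0 < e"
  shows "\<exists>\<phi>::'a \<Rightarrow> real. Cc (\<lambda>x. of_real (\<phi> x)) \<and> (LINT x|M. \<bar>indicator A x - \<phi> x\<bar>) < e"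
proof -
  have "emeasure M A < emeasure M A + ennreal (e / 2)"
    using fin e by (cases "emeasure M A") (auto simp flip: ennreal_plus intro!: ennreal_lessI)
  then obtain U where U: "open U" "A \<subseteq> U" "emeasure M U < emeasure M A + ennreal (e / 2)"
    by (rule outer_regular[OF A])
  have finU: "emeasure M U < \<infinity>"
    using U(3) fin by (metis ennreal_add_eq_top ennreal_neq_top infinity_ennreal_def less_top order_less_trans top.not_eq_extremum)
  then have U': "measure M U < measure M A + e / 2"
    using U(3) fin e by (simp add: emeasure_eq_ennreal_measure less_top[symmetric] flip: ennreal_plus) (simp add: ennreal_less_iff flip: ennreal_plus)
  \<comment> \<open>A negative bound would be truncated to 0 by \<open>ennreal\<close>, and
    \<open>0 < emeasure M U\<close> may fail; the empty set serves in that case.\<close>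
  obtain K where K: "compact K" "K \<subseteq> U" "measure M U - e / 2 < measure M K"
  proof (cases "measure M U - e / 2 < 0")
    case True
    then show ?thesis using that[of "{}"] by simp
  next
    case False
    then have "ennreal (measure M U - e / 2) < emeasure M U"
      using finU e by (simp add: emeasure_eq_ennreal_measure less_top[symmetric] ennreal_less_iff)
    then obtain K where K: "compact K" "K \<subseteq> U" "ennreal (measure M U - e / 2) < emeasure M K"
      by (rule inner_regular[OF U(1)])
    then have "measure M U - e / 2 < measure M K"
      using False emeasure_compact[OF K(1)]
      by (simp add: emeasure_eq_ennreal_measure less_top[symmetric] ennreal_less_iff)
    with K show ?thesis by (intro that) auto
  qed
  obtain W C where W: "open W" "compact C" "K \<subseteq> W" "W \<subseteq> C"
    using compact_neighbourhood[OF K(1)] .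
  \<comment> \<open>\<open>U\<close> keeps the error small, \<open>W\<close> makes the support
    compact.\<close>
  obtain \<phi> :: "'a \<Rightarrow> real" where \<phi>: "continuous_on UNIV \<phi>" "\<And>x. 0 \<le> \<phi> x" "\<And>x. \<phi> x \<le> 1"
    "\<And>x. x \<in> K \<Longrightarrow> \<phi> x = 1" "\<And>x. x \<notin> U \<inter> W \<Longrightarrow> \<phi> x = 0"
    using Urysohn_function[of K "U \<inter> W"] K U W by (metis Int_subset_iff open_Int)
  have Cc: "Cc (\<lambda>x. of_real (\<phi> x))"
    unfolding Cc_def
  proof (intro conjI exI[of _ C] allI impI continuous_intros)
    show "complex_of_real (\<phi> x) = 0" if "x \<notin> C" for x
      using \<phi>(5)[of x] W(4) that by auto
  qed (fact \<phi>(1) W(2))+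
  have sets: "U \<in> sets M" "K \<in> sets M" "A \<in> sets M"
    using U K A by (auto intro: borel_compact)
  have finK: "emeasure M K < \<infinity>" by (rule emeasure_compact) fact
  have fin': "emeasure M (U - B) < \<infinity>" for B
    using sets finU by (intro le_less_trans[OF emeasure_mono finU]) auto
  have int: "integrable M (\<lambda>x. indicator (U - B) x :: real)" if "B \<in> sets M" for B
    using that sets fin' by (intro integrable_real_indicator sets.Diff)
  have "(LINT x|M. \<bar>indicator A x - \<phi> x\<bar>) \<le> (LINT x|M. indicator (U - A) x + indicator (U - K) x)"
  proof (rule integral_mono')
    show "integrable M (\<lambda>x. indicator (U - A) x + indicator (U - K) x :: real)"
      by (intro Bochner_Integration.integrable_add int sets)
    fix x
    show "\<bar>indicator A x - \<phi> x\<bar> \<le> indicator (U - A) x + indicator (U - K) x"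
      using \<phi>(2,3)[of x] \<phi>(4,5)[of x] U(2) K(2) by (auto simp: indicator_def)
  qed auto
  also have "\<dots> = measure M (U - A) + measure M (U - K)"
    using int[OF sets(2)] int[OF sets(3)] sets by simp
  also have "\<dots> = (measure M U - measure M A) + (measure M U - measure M K)"
    using sets finU fin finK U(2) K(2) by (simp add: measure_Diff)
  also have "\<dots> < e"
    using U' K(3) by simp
  finally show ?thesis using Cc by blast
qed

lemma Cc_dense:
  fixes f :: "'a \<Rightarrow> complex"
  assumes "integrable M f" "0 < e"
  shows "\<exists>\<phi>. Cc \<phi> \<and> (LINT x|M. norm (f x - \<phi> x)) < e"
  using assms
proof (induction arbitrary: e rule: integrable_induct)
  case (base A c)
  \<comment> \<open>The summand 1 covers \<open>c = 0\<close> and gives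
    \<open>norm c * d < e\<close>.\<close>
  define d where "d = e / (norm c + 1)"
  have "0 < d" using base(3) by (simp add: d_def add_nonneg_pos)
  obtain \<phi> :: "'a \<Rightarrow> real" where \<phi>: "Cc (\<lambda>x. of_real (\<phi> x))" "(LINT x|M. \<bar>indicator A x - \<phi> x\<bar>) < d"
    using Cc_approx_indicator[of A d] base \<open>0 < d\<close> by auto
  show ?case
  proof (intro exI conjI)
    obtain C where "compact C" "\<forall>x. x \<notin> C \<longrightarrow> complex_of_real (\<phi> x) = 0"
      using \<phi>(1) unfolding Cc_def by metis
    then show "Cc (\<lambda>x. of_real (\<phi> x) * c)"
      using \<phi>(1) unfolding Cc_def by (intro conjI exI[of _ C] continuous_intros) auto
    have "norm (indicator A x *\<^sub>R c - of_real (\<phi> x) * c) = norm c * \<bar>indicator A x - \<phi> x\<bar>" for x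
      by (metis mult.commute norm_scaleR scaleR_conv_of_real scaleR_left_diff_distrib)
    then have "(LINT x|M. norm (indicator A x *\<^sub>R c - of_real (\<phi> x) * c))
        = norm c * (LINT x|M. \<bar>indicator A x - \<phi> x\<bar>)"
      by simp
    also have "\<dots> \<le> norm c * d"
      using \<phi>(2) by (intro mult_left_mono) auto
    also have "\<dots> < (norm c + 1) * d"
      using \<open>0 < d\<close> by (simp add: distrib_right)
    also have "\<dots> = e"
      unfolding d_def using norm_ge_zero[of c] by (simp add: add_nonneg_eq_0_iff)
    finally show "(LINT x|M. norm (indicator A x *\<^sub>R c - of_real (\<phi> x) * c)) < e" .
  qed
next
  case (add f g)
  obtain \<phi> \<psi> where \<phi>: "Cc \<phi>" "(LINT x|M. norm (f x - \<phi> x)) < e / 2"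
    and \<psi>: "Cc \<psi>" "(LINT x|M. norm (g x - \<psi> x)) < e / 2"
    using add.IH add.prems by (metis half_gt_zero)
  have int: "integrable M (\<lambda>x. norm (f x - \<phi> x))" "integrable M (\<lambda>x. norm (g x - \<psi> x))"
    using add.hyps Cc_integrable[OF \<phi>(1)] Cc_integrable[OF \<psi>(1)] by auto
  have "(LINT x|M. norm (f x + g x - (\<phi> x + \<psi> x))) \<le> (LINT x|M. norm (f x - \<phi> x) + norm (g x - \<psi> x))"
    using int by (intro integral_mono') (auto intro: norm_diff_triangle_ineq)
  also have "\<dots> < e"
    using int \<phi>(2) \<psi>(2) by simp
  finally show ?case
    using Cc_add[OF \<phi>(1) \<psi>(1)] by blast
next
  case (lim f s)
  \<comment> \<open>The factor 3 in the dominating function comes from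
    \<open>norm (s i x) \<le> 2 * norm (f x)\<close>.\<close>
  have "(\<lambda>i. LINT x|M. norm (f x - s i x)) \<longlonglongrightarrow> (LINT x|M. norm (f x - f x))"
  proof (rule integral_dominated_convergence[where w = "\<lambda>x. 3 * norm (f x)"])
    show "AE x in M. (\<lambda>i. norm (f x - s i x)) \<longlonglongrightarrow> norm (f x - f x)"
      using lim.hyps by (intro AE_I2 tendsto_intros) auto
    show "AE x in M. norm (norm (f x - s i x)) \<le> 3 * norm (f x)" for i
    proof (rule AE_I2)
      fix x
      show "norm (norm (f x - s i x)) \<le> 3 * norm (f x)"
        using norm_triangle_ineq4[of "f x" "s i x"] lim.hyps(3)[of x i] by simp
    qed
  qed (use lim.hyps in auto)
  then have "eventually (\<lambda>i. (LINT x|M. norm (f x - s i x)) < e / 2) sequentially"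
    using lim.prems by (intro order_tendstoD) auto
  then obtain i where i: "(LINT x|M. norm (f x - s i x)) < e / 2"
    by (auto simp: eventually_sequentially)
  obtain \<phi> where \<phi>: "Cc \<phi>" "(LINT x|M. norm (s i x - \<phi> x)) < e / 2"
    using lim.IH lim.prems by (metis half_gt_zero)
  have int: "integrable M (\<lambda>x. norm (f x - s i x))" "integrable M (\<lambda>x. norm (s i x - \<phi> x))"
    using lim.hyps Cc_integrable[OF \<phi>(1)] by auto
  have "(LINT x|M. norm (f x - \<phi> x)) \<le> (LINT x|M. norm (f x - s i x) + norm (s i x - \<phi> x))"
    using int by (intro integral_mono') (auto intro: norm_diff_triangle_le)
  also have "\<dots> < e"
    using int \<phi>(2) i by simp
  finally show ?case
    using \<phi>(1) by blast
qed

text \<open>Borel measurability of \<open>f\<close> need not give that of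
  \<open>(y, x) \<mapsto> f (- y + x)\<close> for \<open>borel \<Otimes>\<^sub>M borel\<close>. It
  is demanded on \<sigma>-compact rectangles, where continuous functions have it, and in this form
  it passes to pointwise limits.\<close>

definition pair_measurable :: "('a \<Rightarrow> complex) \<Rightarrow> bool" where
  "pair_measurable f \<longleftrightarrow> f \<in> borel_measurable borel \<and> (\<forall>S T. sigma_compact S \<longrightarrow> sigma_compact T \<longrightarrow>
     (\<lambda>p. indicator (S \<times> T) p * f (- fst p + snd p)) \<in> borel_measurable (borel \<Otimes>\<^sub>M borel))"

lemma pair_measurable_Cc: "Cc f \<Longrightarrow> pair_measurable f"
  unfolding pair_measurable_def
  by (intro conjI allI impI borel_measurable_pair_continuous Cc_borel)
    (auto simp: Cc_def intro!: continuous_intros continuous_on_compose2[of UNIV f UNIV "\<lambda>p. - fst p + snd p"])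

text \<open>
  Every \<open>L\<^sup>1\<close> class has a \<open>\<sigma>\<close>-compactly supported representative that is an almost everywhere limit
  of functions in \<open>Cc\<close>. For such representatives the integrand of a convolution is measurable on
  the product, so that the theorems of Tonelli and Fubini apply.
\<close>

lemma good_representative:
  fixes f :: "'a \<Rightarrow> complex"
  assumes f: "integrable M f"
  obtains f0 S where "integrable M f0" "AE x in M. f x = f0 x" "sigma_compact S"
    "\<forall>x. x \<notin> S \<longrightarrow> f0 x = 0" "pair_measurable f0"
proof -
  have "\<exists>\<phi>. Cc \<phi> \<and> (LINT x|M. norm (f x - \<phi> x)) < 1 / Suc n" for n
    by (rule Cc_dense[OF f]) simp
  then obtain \<phi> where \<phi>: "\<And>n. Cc (\<phi> n)" "\<And>n. (LINT x|M. norm (f x - \<phi> n x)) < 1 / Suc n"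
    by metis
  have "(\<lambda>n. LINT x|M. norm (f x - \<phi> n x)) \<longlonglongrightarrow> 0"
  proof (rule tendsto_sandwich[OF _ _ tendsto_const LIMSEQ_inverse_real_of_nat])
    show "\<forall>\<^sub>F n in sequentially. (LINT x|M. norm (f x - \<phi> n x)) \<le> inverse (real (Suc n))"
      using \<phi>(2) by (auto intro!: always_eventually less_imp_le simp: inverse_eq_divide)
  qed auto
  then have "(\<lambda>n. LINT x|M. norm (\<phi> n x - f x)) \<longlonglongrightarrow> 0"
    by (simp only: norm_minus_commute)
  then obtain r where "strict_mono r" and r': "AE x in M. (\<lambda>n. \<phi> (r n) x - f x) \<longlonglongrightarrow> 0"
    using tendsto_L1_AE_subseq[of M "\<lambda>n x. \<phi> n x - f x"] Cc_integrable[OF \<phi>(1)] f by auto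
  have r: "AE x in M. (\<lambda>n. \<phi> (r n) x) \<longlonglongrightarrow> f x"
    using r' by eventually_elim (rule LIM_zero_cancel)
  \<comment> \<open>Where the sequence diverges, \<open>lim\<close> returns some fixed value; this
    concerns a null set. Where all \<open>\<phi> (r n)\<close> vanish the sequence is constantly 0,
    so \<open>f0\<close> is 0 at every point off the supports.\<close>
  define f0 where "f0 x = lim (\<lambda>n. \<phi> (r n) x)" for x
  have [measurable]: "\<phi> n \<in> borel_measurable borel" for n
    using \<phi>(1) by (rule Cc_borel)
  have f0_borel: "f0 \<in> borel_measurable borel"
    unfolding f0_def by measurable
  obtain C where C: "\<And>n. compact (C n)" "\<And>n x. x \<notin> C n \<Longrightarrow> \<phi> n x = 0"
    using \<phi>(1) unfolding Cc_def by metis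
  have ae: "AE x in M. f x = f0 x"
    using r by eventually_elim (simp add: f0_def limI)
  show thesis
  proof
    show "AE x in M. f x = f0 x" by fact
    show "integrable M f0"
      using f f0_borel ae by (subst integrable_cong_AE[of _ _ f]) auto
    show "sigma_compact (\<Union>n. C (r n))"
      by (rule sigma_compact_countable_UN) (auto simp: C)
    show "\<forall>x. x \<notin> (\<Union>n. C (r n)) \<longrightarrow> f0 x = 0"
    proof (intro allI impI)
      fix x assume that: "x \<notin> (\<Union>n. C (r n))"
      have "\<phi> (r n) x = 0" for n using that C by auto
      then show "f0 x = 0" by (simp add: f0_def limI)
    qed
    show "pair_measurable f0"
      unfolding pair_measurable_def
    proof (intro conjI allI impI)
      fix S T :: "'a set" assume ST: "sigma_compact S" "sigma_compact T"
      have meas: "(\<lambda>p. indicator (S \<times> T) p * \<phi> (r n) (- fst p + snd p)) \<in> borel_measurable (borel \<Otimes>\<^sub>M borel)" for n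
        using pair_measurable_Cc[OF \<phi>(1)] ST unfolding pair_measurable_def by blast
      \<comment> \<open>This includes points of divergence: on the rectangle both sides are the same
        \<open>lim\<close>, and off it the sequence is constantly 0.\<close>
      have "indicator (S \<times> T) p * f0 (- fst p + snd p) =
        lim (\<lambda>n. indicator (S \<times> T) p * \<phi> (r n) (- fst p + snd p))" for p
        by (cases "p \<in> S \<times> T") (auto simp: f0_def limI)
      then show "(\<lambda>p. indicator (S \<times> T) p * f0 (- fst p + snd p)) \<in> borel_measurable (borel \<Otimes>\<^sub>M borel)"
        using borel_measurable_lim_metric[OF meas] by simp
    qed fact
  qed
qed

subsection \<open>Reflections of null sets\<close>

lemma sigma_finite_pair: "sigma_compact S \<Longrightarrow> sigma_compact T \<Longrightarrow> pair_sigma_finite (M_on S) (M_on T)"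
  by (intro pair_sigma_finite.intro sigma_finite_M_on)

lemma sets_pair_M_on [measurable_cong, simp]: "sets (M_on S \<Otimes>\<^sub>M M_on T) = sets (borel \<Otimes>\<^sub>M borel)"
  by (intro sets_pair_measure_cong sets_M_on)

lemma borel_measurable_pair_M_on:
  "borel_measurable (M_on S \<Otimes>\<^sub>M M_on T) = borel_measurable (borel \<Otimes>\<^sub>M borel)"
  by (intro measurable_cong_sets sets_pair_M_on refl)

text \<open>The positive factor \<open>emeasure M V\<close> is the one that is cancelled when
  reflected null sets are shown to be null.\<close>

lemma exists_compact_positive: "\<exists>V. compact V \<and> 0 < emeasure M V"
proof -
  have "0 < emeasure M UNIV"
    using haar_nonzero by (simp add: zero_less_iff_neq_zero)
  then show ?thesis
    by (rule inner_regular[OF open_UNIV]) blast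
qed

text \<open>Integrate \<open>\<phi> (- y + x)\<close> over \<open>x \<in> V\<close> and \<open>y \<in> D\<close> in both orders.\<close>

lemma nn_integral_reflect_le:
  fixes \<phi> :: "'a \<Rightarrow> real"
  assumes \<phi>: "continuous_on UNIV \<phi>" "\<And>x. 0 \<le> \<phi> x" "\<And>x. x \<notin> C \<Longrightarrow> \<phi> x = 0"
    and C: "compact C" and V: "compact V"
  defines "D \<equiv> (\<lambda>(v, c). v - c) ` (V \<times> C)"
  shows "emeasure M V * (\<integral>\<^sup>+y. \<phi> (- y) \<partial>M) \<le> emeasure M D * (\<integral>\<^sup>+x. \<phi> x \<partial>M)"
proof -
  have D: "compact D"
    unfolding D_def split_beta diff_conv_add_uminus
    by (intro compact_continuous_image compact_Times V C continuous_intros)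
  have [measurable]: "D \<in> sets borel" "V \<in> sets borel"
    using D V by (auto intro: borel_compact)
  have [measurable]: "\<phi> \<in> borel_measurable borel"
    using \<phi>(1) by (intro borel_measurable_continuous_onI)
  interpret pair_sigma_finite "M_on V" "M_on D"
    by (intro sigma_finite_pair sigma_compact_compact V D)
  define F where "F p = ennreal (indicator (V \<times> D) p * \<phi> (- snd p + fst p))" for p
  have "(\<lambda>p. indicator (V \<times> D) p * \<phi> (- snd p + fst p)) \<in> borel_measurable (borel \<Otimes>\<^sub>M borel)"
    by (intro borel_measurable_pair_continuous_real sigma_compact_compact V D
        continuous_on_compose2[OF \<phi>(1)] continuous_intros) auto
  then have F [measurable]: "F \<in> borel_measurable (borel \<Otimes>\<^sub>M borel)"
    unfolding F_def by measurable
  \<comment> \<open>For \<open>x \<in> V\<close> the set \<open>D\<close> contains every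
    \<open>y\<close> with \<open>\<phi> (- y + x) \<noteq> 0\<close>, so restricting to
    \<open>D\<close> loses nothing; then \<open>y \<mapsto> x + y\<close> turns
    \<open>- y + x\<close> into \<open>- y\<close>.\<close>
  have inner: "(\<integral>\<^sup>+y. F (x, y) \<partial>M_on D) = indicator V x * (\<integral>\<^sup>+y. \<phi> (- y) \<partial>M)" for x
  proof (cases "x \<in> V")
    case True
    have "(\<integral>\<^sup>+y. F (x, y) \<partial>M_on D) = (\<integral>\<^sup>+y. indicator D y * F (x, y) \<partial>M)"
      by (rule nn_integral_M_on) measurable
    also have "\<dots> = (\<integral>\<^sup>+y. \<phi> (- y + x) \<partial>M)"
    proof (rule nn_integral_cong)
      fix y
      have "y \<in> D" if "\<phi> (- y + x) \<noteq> 0"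
      proof -
        have "- y + x \<in> C" using that \<phi>(3) by blast
        moreover have "y = x - (- y + x)"
          by (simp only: diff_conv_add_uminus minus_add minus_minus right_minus add_0_left flip: add.assoc)
        ultimately show ?thesis using True unfolding D_def by (intro image_eqI[where x = "(x, - y + x)"]) simp_all
      qed
      then show "indicator D y * F (x, y) = ennreal (\<phi> (- y + x))"
        using True by (cases "\<phi> (- y + x) = 0") (auto simp: F_def)
    qed
    also have "\<dots> = (\<integral>\<^sup>+y. \<phi> (- (x + y) + x) \<partial>M)"
      by (rule nn_integral_translate[symmetric]) measurable
    also have "\<dots> = (\<integral>\<^sup>+y. \<phi> (- y) \<partial>M)"
      by (simp add: minus_add add.assoc del: add_uminus_conv_diff)
    finally show ?thesis using True by simp
  next
    case False
    then show ?thesis by (simp add: F_def)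
  qed
  have "emeasure M V * (\<integral>\<^sup>+y. \<phi> (- y) \<partial>M) = (\<integral>\<^sup>+x. (\<integral>\<^sup>+y. \<phi> (- y) \<partial>M) * indicator V x \<partial>M)"
    by (subst nn_integral_cmult_indicator) (auto simp: mult.commute)
  also have "\<dots> = (\<integral>\<^sup>+x. (\<integral>\<^sup>+y. F (x, y) \<partial>M_on D) \<partial>M_on V)"
    unfolding inner by (subst nn_integral_M_on) (auto intro!: nn_integral_cong simp: indicator_def)
  also have "\<dots> = (\<integral>\<^sup>+y. (\<integral>\<^sup>+x. F (x, y) \<partial>M_on V) \<partial>M_on D)"
    by (rule Fubini[symmetric]) (simp add: borel_measurable_pair_M_on)
  \<comment> \<open>For fixed \<open>y\<close>, dropping the restriction to \<open>V\<close> and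
    translating leaves the full integral of \<open>\<phi>\<close>, independent of
    \<open>y\<close>.\<close>
  also have "\<dots> \<le> (\<integral>\<^sup>+y. (\<integral>\<^sup>+x. \<phi> x \<partial>M) \<partial>M_on D)"
  proof (rule nn_integral_mono)
    fix y
    have "(\<integral>\<^sup>+x. F (x, y) \<partial>M_on V) = (\<integral>\<^sup>+x. indicator V x * F (x, y) \<partial>M)"
      by (rule nn_integral_M_on) measurable
    also have "\<dots> \<le> (\<integral>\<^sup>+x. \<phi> (- y + x) \<partial>M)"
      using \<phi>(2) by (intro nn_integral_mono) (auto simp: F_def indicator_def)
    also have "\<dots> = (\<integral>\<^sup>+x. \<phi> x \<partial>M)"
      by (rule nn_integral_translate) measurable
    finally show "(\<integral>\<^sup>+x. F (x, y) \<partial>M_on V) \<le> (\<integral>\<^sup>+x. \<phi> x \<partial>M)" .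
  qed
  also have "\<dots> = emeasure M D * (\<integral>\<^sup>+x. \<phi> x \<partial>M)"
    by (subst nn_integral_M_on) (auto simp: nn_integral_multc)
  finally show ?thesis .
qed

text \<open>\<open>N\<close> has open neighbourhoods \<open>U\<close> of measure below any
  \<open>e\<close>. Urysohn functions carry the estimate of \<open>nn_integral_reflect_le\<close>
  over to the reflection of \<open>U \<inter> W\<close>, which bounds the measure sought, times that
  of \<open>V\<close>, by \<open>e\<close> times the finite measure of \<open>D\<close>.\<close>

lemma null_reflect_compact:
  assumes N: "N \<in> sets borel" "emeasure M N = 0" and K: "compact K"
  shows "emeasure M (K \<inter> uminus -` N) = 0"
proof -
  obtain V where V: "compact V" "0 < emeasure M V"
    using exists_compact_positive by blast
  have K': "compact (uminus ` K)"
    by (intro compact_continuous_image continuous_intros K)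
  \<comment> \<open>Fixing \<open>C\<close> before \<open>U\<close> makes \<open>D\<close>, and with
    it the factor in the estimate, independent of \<open>e\<close>.\<close>
  obtain W C where W: "open W" "compact C" "uminus ` K \<subseteq> W" "W \<subseteq> C"
    using compact_neighbourhood[OF K'] .
  define D where "D = (\<lambda>(v, c). v - c) ` (V \<times> C)"
  have D: "compact D"
    unfolding D_def split_beta diff_conv_add_uminus
    by (intro compact_continuous_image compact_Times V W continuous_intros)
  let ?A = "K \<inter> uminus -` N"
  have le: "emeasure M V * emeasure M ?A \<le> emeasure M D * ennreal e" if "0 < e" for e :: real
  proof -
    obtain U where U: "open U" "N \<subseteq> U" "emeasure M U < ennreal e"
      by (rule outer_regular[OF N(1), of "ennreal e"]) (simp_all add: N(2) \<open>0 < e\<close>)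
    let ?U = "uminus -` (U \<inter> W)"
    have oU: "open ?U"
      by (intro open_vimage open_Int U W continuous_intros)
    have "?A \<subseteq> ?U"
      using U W by auto
    then have "emeasure M V * emeasure M ?A \<le> emeasure M V * emeasure M ?U"
      using oU by (intro mult_left_mono emeasure_mono) auto
    \<comment> \<open>Inner regularity of the open set \<open>?U\<close> leaves only compact subsets
      \<open>L\<close>, each handled by a Urysohn function for its reflection.\<close>
    also have "\<dots> = (SUP L\<in>{L. compact L \<and> L \<subseteq> ?U}. emeasure M V * emeasure M L)"
      by (subst haar_inner[OF oU]) (rule SUP_mult_left_ennreal)
    also have "\<dots> \<le> emeasure M D * ennreal e"
    proof (rule SUP_least)
      fix L assume "L \<in> {L. compact L \<and> L \<subseteq> ?U}"
      then have L: "compact L" "L \<subseteq> ?U" by auto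
      have L': "compact (uminus ` L)"
        by (intro compact_continuous_image continuous_intros L)
      obtain \<phi> :: "'a \<Rightarrow> real" where \<phi>: "continuous_on UNIV \<phi>" "\<And>x. 0 \<le> \<phi> x" "\<And>x. \<phi> x \<le> 1"
        "\<And>x. x \<in> uminus ` L \<Longrightarrow> \<phi> x = 1" "\<And>x. x \<notin> U \<inter> W \<Longrightarrow> \<phi> x = 0"
        by (rule Urysohn_function[OF L', of "U \<inter> W"]) (use L U W in auto)
      have "emeasure M L = (\<integral>\<^sup>+y. indicator L y \<partial>M)"
        using L by (simp add: borel_compact)
      also have "\<dots> \<le> (\<integral>\<^sup>+y. \<phi> (- y) \<partial>M)"
        using \<phi>(4) by (intro nn_integral_mono) (auto simp: indicator_def)
      finally have "emeasure M V * emeasure M L \<le> emeasure M V * (\<integral>\<^sup>+y. \<phi> (- y) \<partial>M)"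
        by (rule mult_left_mono) simp
      also have "\<dots> \<le> emeasure M D * (\<integral>\<^sup>+x. \<phi> x \<partial>M)"
        unfolding D_def
      proof (intro nn_integral_reflect_le \<phi>(1,2) W(2) V(1))
        show "\<phi> x = 0" if "x \<notin> C" for x
          using \<phi>(5)[of x] W(4) that by auto
      qed
      also have "\<dots> \<le> emeasure M D * (\<integral>\<^sup>+x. indicator U x \<partial>M)"
        using \<phi>(2,3,5) by (intro mult_left_mono nn_integral_mono) (auto simp: indicator_def)
      also have "\<dots> \<le> emeasure M D * ennreal e"
        using U by (intro mult_left_mono) auto
      finally show "emeasure M V * emeasure M L \<le> emeasure M D * ennreal e" .
    qed
    finally show ?thesis .
  qed
  have "emeasure M V * emeasure M ?A \<le> 0"
  proof (rule ennreal_le_epsilon)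
    fix e :: real assume "0 < e"
    define d where "d = measure M D"
    have d: "emeasure M D = ennreal d" "0 \<le> d"
      using emeasure_compact[OF D] by (auto simp: d_def emeasure_eq_ennreal_measure less_top)
    \<comment> \<open>The denominator \<open>d + 1\<close> covers the case
      \<open>d = 0\<close>.\<close>
    have "emeasure M V * emeasure M ?A \<le> ennreal d * ennreal (e / (d + 1))"
      using le[of "e / (d + 1)"] d \<open>0 < e\<close> by (simp add: add_nonneg_pos)
    also have "\<dots> = ennreal (d * (e / (d + 1)))"
      using d \<open>0 < e\<close> by (intro ennreal_mult[symmetric]) auto
    also have "\<dots> \<le> ennreal e"
      using d \<open>0 < e\<close> by (intro ennreal_leI) (simp add: field_simps)
    finally show "emeasure M V * emeasure M ?A \<le> 0 + ennreal e" by simp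
  qed
  then show ?thesis
    using V(2) by (auto simp: less_le)
qed

text \<open>\<open>- y + x\<close> is the negative of \<open>- x + y\<close>, so the exceptional set
  is a left translate of a reflected null set. It is null in each compact piece of \<open>S\<close>,
  and there are countably many pieces.\<close>

lemma AE_flip:
  assumes P: "AE z in M. P z" and S: "sigma_compact S"
  shows "AE y in M. y \<in> S \<longrightarrow> P (- y + x)"
proof -
  obtain K where K: "\<And>i::nat. compact (K i)" "S = (\<Union>i. K i)"
    using S unfolding sigma_compact_def by metis
  obtain N where N: "N \<in> sets borel" "emeasure M N = 0" "{z. \<not> P z} \<subseteq> N"
    using P by (auto elim!: AE_E)
  have "AE y in M. y \<in> K i \<longrightarrow> P (- y + x)" for i
  proof -
    let ?K = "(\<lambda>y. - x + y) ` K i"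
    have cK: "compact ?K"
      by (intro compact_continuous_image continuous_intros K)
    have "AE z in M. \<not> (z \<in> ?K \<inter> uminus -` N)"
    proof (rule AE_I[of _ _ "?K \<inter> uminus -` N"])
      show "emeasure M (?K \<inter> uminus -` N) = 0"
        by (rule null_reflect_compact[OF N(1,2) cK])
      have "uminus -` N \<in> sets (borel :: 'a measure)"
        using measurable_sets[OF measurable_uminus_group N(1)] by simp
      then show "?K \<inter> uminus -` N \<in> sets M"
        using borel_compact[OF cK] by auto
    qed auto
    then have "AE y in M. \<not> (- x + y \<in> ?K \<inter> uminus -` N)"
      by (rule AE_translate)
    then show ?thesis
    proof eventually_elim
      case (elim y)
      have "- (- x + y) = - y + x" by (simp add: minus_add)
      with elim N(3) show ?case by (auto simp del: minus_add_distrib)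
    qed
  qed
  then have "AE y in M. \<forall>i. y \<in> K i \<longrightarrow> P (- y + x)"
    unfolding AE_all_countable by blast
  then show ?thesis
    unfolding K(2) by eventually_elim blast
qed

subsection \<open>Convolution\<close>

text \<open>Exchanges \<open>M\<close> with the \<sigma>-finite \<open>M_on S\<close> for integrands
  that vanish off \<open>S\<close>.\<close>

lemma M_on_vanishing:
  fixes f :: "'a \<Rightarrow> 'b::{banach, second_countable_topology}"
  assumes S: "sigma_compact S" and f: "f \<in> borel_measurable borel" and 0: "\<And>x. x \<notin> S \<Longrightarrow> f x = 0"
  shows integrable_M_on_vanishing: "integrable (M_on S) f \<longleftrightarrow> integrable M f"
    and integral_M_on_vanishing: "(LINT x|M_on S. f x) = (LINT x|M. f x)"
proof -
  have [measurable]: "S \<in> sets borel" by (rule borel_sigma_compact) fact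
  have eq: "indicat_real S x *\<^sub>R f x = f x" for x
    using 0[of x] by (cases "x \<in> S") auto
  show "integrable (M_on S) f \<longleftrightarrow> integrable M f"
    unfolding M_on_def using f by (subst integrable_density) (auto simp: eq)
  show "(LINT x|M_on S. f x) = (LINT x|M. f x)"
    unfolding M_on_def using f by (subst integral_density) (auto simp: eq)
qed

lemma integrable_borel: "integrable M f \<Longrightarrow> f \<in> borel_measurable borel"
  using borel_measurable_integrable[of M f] by simp

text \<open>A total function: where the integrand is not integrable the value is the default 0. For
  integrable \<open>f\<close> and \<open>g\<close> this happens only on a null set, by
  \<open>AE_integrable_conv\<close>.\<close>

definition conv :: "('a \<Rightarrow> complex) \<Rightarrow> ('a \<Rightarrow> complex) \<Rightarrow> 'a \<Rightarrow> complex" where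
  "conv f g x = (LINT y|M. f y * g (- y + x))"

lemma borel_measurable_flip [measurable (raw)]:
  fixes g :: "'a \<Rightarrow> 'b"
  shows "g \<in> measurable borel N \<Longrightarrow> (\<lambda>y. g (- y + x)) \<in> measurable borel N"
  by (rule measurable_compose[OF measurable_flip])

text \<open>A nonzero value needs \<open>y \<in> S\<close> and \<open>- y + x \<in> T\<close>, so
  the indicator of \<open>S \<times> ?T\<close> can be inserted, and there
  \<open>pair_measurable g\<close> applies.\<close>

lemma measurable_conv_kernel:
  assumes f: "f \<in> borel_measurable borel" and S: "sigma_compact S" "\<forall>x. x \<notin> S \<longrightarrow> f x = 0"
    and g: "pair_measurable g" and T: "sigma_compact T" "\<forall>x. x \<notin> T \<longrightarrow> g x = 0"
  shows "(\<lambda>(y, x). f y * g (- y + x)) \<in> borel_measurable (borel \<Otimes>\<^sub>M borel)"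
proof -
  let ?T = "{s + t |s t. s \<in> S \<and> t \<in> T}"
  have [measurable]: "f \<in> borel_measurable borel" by fact
  have [measurable]: "(\<lambda>p. indicator (S \<times> ?T) p * g (- fst p + snd p)) \<in> borel_measurable (borel \<Otimes>\<^sub>M borel)"
    using g S(1) T(1) sigma_compact_add unfolding pair_measurable_def by blast
  have "f y * g (- y + x) = f y * (indicator (S \<times> ?T) (y, x) * g (- y + x))" for y x
  proof (cases "f y = 0 \<or> g (- y + x) = 0")
    case False
    then have "y \<in> S" "- y + x \<in> T" using S T by metis+
    moreover have "x = y + (- y + x)" by (simp flip: add.assoc)
    ultimately have "(y, x) \<in> S \<times> ?T" by blast
    then show ?thesis by simp
  qed auto
  then have "(\<lambda>(y, x). f y * g (- y + x)) =
      (\<lambda>p. f (fst p) * (indicator (S \<times> ?T) p * g (- fst p + snd p)))"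
    by (auto simp: fun_eq_iff)
  also have "\<dots> \<in> borel_measurable (borel \<Otimes>\<^sub>M borel)"
    by measurable
  finally show ?thesis .
qed

lemma integral_norm_flip:
  "g \<in> borel_measurable borel \<Longrightarrow> (LINT x|M. norm (f y * g (- y + x) :: complex)) = norm (f y) * (LINT x|M. norm (g x))"
  using integral_translate[of "\<lambda>x. norm (g x)" "- y"] by (simp add: norm_mult)

text \<open>Fubini on \<open>S \<times> T'\<close>, off which the integrand is 0. With
  \<open>x\<close> integrated first, left invariance makes the inner integral of the modulus equal
  to \<open>norm (f y)\<close> times the norm of \<open>g\<close>, which is integrable in
  \<open>y\<close>.\<close>

lemma conv_good:
  assumes f: "integrable M f" and S: "sigma_compact S" "\<forall>x. x \<notin> S \<longrightarrow> f x = 0"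
    and g: "integrable M g" "pair_measurable g" and T: "sigma_compact T" "\<forall>x. x \<notin> T \<longrightarrow> g x = 0"
  shows "integrable M (conv f g)"
    and "AE x in M. integrable M (\<lambda>y. f y * g (- y + x))"
    and "(LINT x|M. norm (conv f g x)) \<le> (LINT x|M. norm (f x)) * (LINT x|M. norm (g x))"
proof -
  define T' where "T' = {s + t |s t. s \<in> S \<and> t \<in> T}"
  have T': "sigma_compact T'"
    unfolding T'_def by (intro sigma_compact_add S T)
  have [measurable]: "f \<in> borel_measurable borel" "g \<in> borel_measurable borel"
    using f g by (auto intro: integrable_borel)
  have 0: "f y * g (- y + x) = 0" if "y \<notin> S \<or> x \<notin> T'" for y x
  proof (rule ccontr)
    assume "f y * g (- y + x) \<noteq> 0"
    then have "y \<in> S" "- y + x \<in> T" using S T by fastforce+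
    moreover have "x = y + (- y + x)" by (simp flip: add.assoc)
    ultimately have "y \<in> S" "x \<in> T'" unfolding T'_def by blast+
    with that show False by blast
  qed
  interpret P: pair_sigma_finite "M_on S" "M_on T'"
    by (intro sigma_finite_pair S T')
  define F where "F = (\<lambda>y x. f y * g (- y + x))"
  have F_meas: "case_prod F \<in> borel_measurable (M_on S \<Otimes>\<^sub>M M_on T')"
    unfolding borel_measurable_pair_M_on F_def by (rule measurable_conv_kernel[OF _ S g(2) T]) measurable
  have tr: "integrable M (\<lambda>x. g (- y + x))" for y
    using g by (simp add: integrable_translate)
  have F_int: "integrable (M_on S \<Otimes>\<^sub>M M_on T') (case_prod F)"
  proof (rule P.Fubini_integrable[OF F_meas])
    have "(LINT x|M_on T'. norm (case_prod F (y, x))) = norm (f y) * (LINT x|M. norm (g x))" for y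
    proof -
      have "(LINT x|M_on T'. norm (case_prod F (y, x))) = (LINT x|M. norm (F y x))"
        unfolding prod.case by (rule integral_M_on_vanishing[OF T']) (auto simp: F_def 0)
      then show ?thesis by (simp only: F_def integral_norm_flip[OF \<open>g \<in> borel_measurable borel\<close>])
    qed
    then show "integrable (M_on S) (\<lambda>y. LINT x|M_on T'. norm (case_prod F (y, x)))"
      using f S by (simp add: integrable_M_on_vanishing)
    show "AE y in M_on S. integrable (M_on T') (\<lambda>x. case_prod F (y, x))"
    proof (rule AE_I2)
      fix y
      have "integrable M (\<lambda>x. F y x)"
        unfolding F_def by (intro integrable_mult_right tr)
      then show "integrable (M_on T') (\<lambda>x. case_prod F (y, x))"
        unfolding prod.case by (subst integrable_M_on_vanishing[OF T']) (auto simp: F_def 0)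
    qed
  qed
  have conv_eq: "conv f g = (\<lambda>x. LINT y|M_on S. F y x)"
    unfolding conv_def F_def by (intro ext integral_M_on_vanishing[symmetric] S) (auto simp: 0)
  have conv_T': "integrable (M_on T') (conv f g)"
    unfolding conv_eq by (rule P.integrable_snd[OF F_int])
  then have conv_meas: "conv f g \<in> borel_measurable borel"
    using borel_measurable_integrable[OF conv_T'] by (simp cong: measurable_cong_sets)
  have conv_0: "conv f g x = 0" if "x \<notin> T'" for x
    using that by (simp add: conv_def 0)
  show "integrable M (conv f g)"
    using conv_T' integrable_M_on_vanishing[OF T' conv_meas conv_0] by simp
  have "AE x in M_on T'. integrable (M_on S) (\<lambda>y. F y x)"
    by (rule P.AE_integrable_snd[OF F_int])
  then have "AE x in M. x \<in> T' \<longrightarrow> integrable (M_on S) (\<lambda>y. F y x)"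
    using T' by (simp add: AE_M_on borel_sigma_compact)
  then show "AE x in M. integrable M (\<lambda>y. f y * g (- y + x))"
  proof eventually_elim
    case (elim x)
    show ?case
    proof (cases "x \<in> T'")
      case True
      with elim show ?thesis
        by (subst (asm) integrable_M_on_vanishing[OF S(1)]) (auto simp: F_def 0)
    next
      case False
      then show ?thesis by (simp add: 0)
    qed
  qed
  have nF_int: "integrable (M_on S \<Otimes>\<^sub>M M_on T') (case_prod (\<lambda>y x. norm (F y x)))"
    using integrable_norm[OF F_int] by (simp add: split_beta')
  have "(LINT x|M. norm (conv f g x)) = (LINT x|M_on T'. norm (conv f g x))"
    by (rule integral_M_on_vanishing[OF T', symmetric]) (use conv_meas conv_0 in auto)
  also have "\<dots> \<le> (LINT x|M_on T'. LINT y|M_on S. norm (F y x))"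
    unfolding conv_eq
    by (intro integral_mono P.integrable_snd[OF nF_int] integrable_norm P.integrable_snd[OF F_int] integral_norm_bound)
  also have "\<dots> = (LINT y|M_on S. LINT x|M_on T'. norm (F y x))"
    by (rule P.Fubini_integral[OF nF_int])
  also have "\<dots> = (LINT y|M_on S. norm (f y) * (LINT x|M. norm (g x)))"
  proof (rule Bochner_Integration.integral_cong[OF refl])
    fix y
    have "(LINT x|M_on T'. norm (F y x)) = (LINT x|M. norm (F y x))"
      by (rule integral_M_on_vanishing[OF T']) (auto simp: F_def 0)
    then show "(LINT x|M_on T'. norm (F y x)) = norm (f y) * (LINT x|M. norm (g x))"
      by (simp only: F_def integral_norm_flip[OF \<open>g \<in> borel_measurable borel\<close>])
  qed
  also have "\<dots> = (LINT y|M. norm (f y) * (LINT x|M. norm (g x)))"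
    by (rule integral_M_on_vanishing) (use S in auto)
  also have "\<dots> = (LINT x|M. norm (f x)) * (LINT x|M. norm (g x))"
    by simp
  finally show "(LINT x|M. norm (conv f g x)) \<le> (LINT x|M. norm (f x)) * (LINT x|M. norm (g x))" .
qed

text \<open>The convolution does not depend on the representatives at any point, not only almost everywhere.\<close>

lemma conv_integrand_cong_AE:
  fixes f f' g g' :: "'a \<Rightarrow> complex"
  assumes f: "integrable M f" and ff': "AE x in M. f x = f' x" and gg': "AE x in M. g x = g' x"
  shows "AE y in M. f y * g (- y + x) = f' y * g' (- y + x)"
proof -
  obtain f0 S where f0: "AE x in M. f x = f0 x" "sigma_compact S" "\<forall>x. x \<notin> S \<longrightarrow> f0 x = 0"
    using good_representative[OF f] by metis
  \<comment> \<open>The flipped equality is known for \<open>y \<in> S\<close>; off \<open>S\<close>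
    both products vanish, since \<open>f\<close> and \<open>f'\<close> agree with \<open>f0\<close>
    almost everywhere.\<close>
  from ff' f0(1) AE_flip[OF gg' f0(2), of x] show ?thesis
  proof eventually_elim
    case (elim y)
    then show ?case using f0(3) by (cases "y \<in> S") auto
  qed
qed

lemma conv_cong_AE:
  fixes f f' g g' :: "'a \<Rightarrow> complex"
  assumes "integrable M f" "AE x in M. f x = f' x" "AE x in M. g x = g' x"
    and [measurable]: "f' \<in> borel_measurable borel" "g \<in> borel_measurable borel" "g' \<in> borel_measurable borel"
  shows "conv f g = conv f' g'"
proof
  fix x
  have [measurable]: "f \<in> borel_measurable borel" by (rule integrable_borel) fact
  show "conv f g x = conv f' g' x"
    unfolding conv_def by (intro integral_cong_AE conv_integrand_cong_AE assms) measurable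
qed

lemma conv_L1:
  assumes f: "integrable M f" and g: "integrable M g"
  shows integrable_conv: "integrable M (conv f g)"
    and AE_integrable_conv: "AE x in M. integrable M (\<lambda>y. f y * g (- y + x))"
    and norm_conv_le: "(LINT x|M. norm (conv f g x)) \<le> (LINT x|M. norm (f x)) * (LINT x|M. norm (g x))"
proof -
  obtain f0 S where f0: "integrable M f0" "AE x in M. f x = f0 x" "sigma_compact S" "\<forall>x. x \<notin> S \<longrightarrow> f0 x = 0"
    using good_representative[OF f] by metis
  obtain g0 T where g0: "integrable M g0" "AE x in M. g x = g0 x" "sigma_compact T" "\<forall>x. x \<notin> T \<longrightarrow> g0 x = 0"
    "pair_measurable g0"
    using good_representative[OF g] by metis
  have [measurable]: "f \<in> borel_measurable borel" "g \<in> borel_measurable borel"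
    "f0 \<in> borel_measurable borel" "g0 \<in> borel_measurable borel"
    using f g f0 g0 by (auto intro: integrable_borel)
  have eq: "conv f g = conv f0 g0"
    using f f0 g0 by (intro conv_cong_AE) auto
  note good = conv_good[OF f0(1,3,4) g0(1,5,3,4)]
  show "integrable M (conv f g)"
    unfolding eq by (rule good)
  from good(2) show "AE x in M. integrable M (\<lambda>y. f y * g (- y + x))"
  proof eventually_elim
    case (elim x)
    show ?case
      by (subst integrable_cong_AE[OF _ _ conv_integrand_cong_AE[OF f f0(2) g0(2)]]) (use elim in auto)
  qed
  have "(LINT x|M. norm (f x)) = (LINT x|M. norm (f0 x))" "(LINT x|M. norm (g x)) = (LINT x|M. norm (g0 x))"
    using f0(2) g0(2) by (auto intro!: integral_cong_AE)
  then show "(LINT x|M. norm (conv f g x)) \<le> (LINT x|M. norm (f x)) * (LINT x|M. norm (g x))"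
    unfolding eq using good(3) by simp
qed

section \<open>Algebraic laws of convolution\<close>

lemma is_convolution_iff:
  assumes f: "integrable M f" and g: "integrable M g"
  shows "is_convolution M f g h \<longleftrightarrow> (AE x in M. h x = conv f g x)"
proof
  assume "is_convolution M f g h"
  then show "AE x in M. h x = conv f g x"
    unfolding is_convolution_def
    by eventually_elim (simp add: conv_def has_bochner_integral_integral_eq)
next
  assume "AE x in M. h x = conv f g x"
  with AE_integrable_conv[OF f g] show "is_convolution M f g h"
    unfolding is_convolution_def
    by eventually_elim (simp add: conv_def has_bochner_integral_integrable)
qed

text \<open>Almost everywhere only: where one of the integrals does not exist, its default value 0
  can break additivity. The scaling laws respect the default and hold at every point.\<close>

lemma conv_add_left:
  assumes "integrable M f" "integrable M f'" "integrable M g"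
  shows "AE x in M. conv (\<lambda>x. f x + f' x) g x = conv f g x + conv f' g x"
  using AE_integrable_conv[OF assms(1,3)] AE_integrable_conv[OF assms(2,3)]
  by eventually_elim (simp add: conv_def distrib_right)

lemma conv_add_right:
  assumes "integrable M f" "integrable M g" "integrable M g'"
  shows "AE x in M. conv f (\<lambda>x. g x + g' x) x = conv f g x + conv f g' x"
  using AE_integrable_conv[OF assms(1,2)] AE_integrable_conv[OF assms(1,3)]
  by eventually_elim (simp add: conv_def distrib_left)

lemma conv_scale_left: "conv (\<lambda>x. c * f x) g x = c * conv f g x"
  by (simp add: conv_def mult.assoc)

lemma conv_scale_right: "conv f (\<lambda>x. c * g x) x = c * conv f g x"
  by (simp add: conv_def mult.left_commute)

text \<open>Fubini in \<open>(z, y)\<close> for each \<open>x\<close> at which the convolution of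
  the moduli exists. Since \<open>x\<close> is fixed, \<open>k\<close> enters as a function of
  \<open>z\<close> alone, so its Borel measurability is enough.\<close>

lemma conv_assoc_good:
  assumes f: "integrable M f" and S: "sigma_compact S" "\<forall>x. x \<notin> S \<longrightarrow> f x = 0"
    and g: "integrable M g" "pair_measurable g" and T: "sigma_compact T" "\<forall>x. x \<notin> T \<longrightarrow> g x = 0"
    and k: "integrable M k"
  shows "AE x in M. conv (conv f g) k x = conv f (conv g k) x"
proof -
  define T' where "T' = {s + t |s t. s \<in> S \<and> t \<in> T}"
  have T': "sigma_compact T'"
    unfolding T'_def by (intro sigma_compact_add S T)
  have [measurable]: "f \<in> borel_measurable borel" "g \<in> borel_measurable borel" "k \<in> borel_measurable borel"
    using f g k by (auto intro: integrable_borel)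
  have 0: "f y * g (- y + z) = 0" if "y \<notin> S \<or> z \<notin> T'" for y z
  proof (rule ccontr)
    assume "f y * g (- y + z) \<noteq> 0"
    then have "y \<in> S" "- y + z \<in> T" using S T by fastforce+
    moreover have "z = y + (- y + z)" by (simp flip: add.assoc)
    ultimately have "y \<in> S" "z \<in> T'" unfolding T'_def by blast+
    with that show False by blast
  qed
  interpret P: pair_sigma_finite "M_on T'" "M_on S"
    by (intro sigma_finite_pair S T')
  \<comment> \<open>Moduli, cast to complex numbers so that \<open>conv\<close> applies; their
    iterated convolution supplies the integrability for Fubini.\<close>
  define af ag ak where "af = (\<lambda>x. complex_of_real (norm (f x)))"
    and "ag = (\<lambda>x. complex_of_real (norm (g x)))" and "ak = (\<lambda>x. complex_of_real (norm (k x)))"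
  have int: "integrable M af" "integrable M ag" "integrable M ak"
    unfolding af_def ag_def ak_def using f g k by auto
  have conv_int: "integrable M (conv af ag)" "integrable M (conv f g)"
    by (intro integrable_conv int f g)+
  have [measurable]: "conv af ag \<in> borel_measurable borel" "conv f g \<in> borel_measurable borel"
    using conv_int by (auto intro: integrable_borel)
  have conv_abs: "norm (conv af ag z) = (LINT y|M. norm (f y * g (- y + z)))" for z
  proof -
    have "conv af ag z = complex_of_real (LINT y|M. norm (f y * g (- y + z)))"
      unfolding conv_def af_def ag_def by (simp add: norm_mult flip: of_real_mult integral_complex_of_real)
    then show ?thesis by simp
  qed
  show ?thesis
    using AE_integrable_conv[OF conv_int(1) int(3)]
  proof eventually_elim
    case (elim x)
    define G where "G = (\<lambda>z y. f y * g (- y + z) * k (- z + x))"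
    have "(\<lambda>(y, z). f y * g (- y + z)) \<in> borel_measurable (borel \<Otimes>\<^sub>M borel)"
      by (rule measurable_conv_kernel[OF _ S g(2) T]) measurable
    then have "(\<lambda>(z, y). f y * g (- y + z)) \<in> borel_measurable (borel \<Otimes>\<^sub>M borel)"
      by (subst (asm) measurable_pair_swap_iff) (simp add: split_beta')
    then have "case_prod G \<in> borel_measurable (borel \<Otimes>\<^sub>M borel)"
      unfolding G_def split_beta' by measurable
    then have G_meas: "case_prod G \<in> borel_measurable (M_on T' \<Otimes>\<^sub>M M_on S)"
      by (simp add: borel_measurable_pair_M_on)
    have G_int: "integrable (M_on T' \<Otimes>\<^sub>M M_on S) (case_prod G)"
    proof (rule P.Fubini_integrable[OF G_meas])
      have "(LINT y|M_on S. norm (case_prod G (z, y))) = norm (conv af ag z * ak (- z + x))" for z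
      proof -
        have "(LINT y|M_on S. norm (case_prod G (z, y))) = (LINT y|M. norm (G z y))"
          unfolding prod.case by (rule integral_M_on_vanishing[OF S(1)]) (auto simp: G_def 0)
        also have "\<dots> = (LINT y|M. norm (f y * g (- y + z)) * norm (k (- z + x)))"
          by (simp add: G_def norm_mult)
        also have "\<dots> = norm (conv af ag z * ak (- z + x))"
          by (simp add: conv_abs norm_mult ak_def)
        finally show ?thesis .
      qed
      moreover have "integrable (M_on T') (\<lambda>z. norm (conv af ag z * ak (- z + x)))"
      proof (subst integrable_M_on_vanishing[OF T'])
        show "(\<lambda>z. norm (conv af ag z * ak (- z + x))) \<in> borel_measurable borel"
          using int(3)[THEN integrable_borel] by measurable
        show "norm (conv af ag z * ak (- z + x)) = 0" if "z \<notin> T'" for z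
          using that by (simp add: norm_mult conv_abs 0)
        show "integrable M (\<lambda>z. norm (conv af ag z * ak (- z + x)))"
          using elim by (rule integrable_norm)
      qed
      ultimately show "integrable (M_on T') (\<lambda>z. LINT y|M_on S. norm (case_prod G (z, y)))"
        by simp
      have "AE z in M. integrable (M_on S) (\<lambda>y. G z y)"
        using AE_integrable_conv[OF f g(1)]
      proof eventually_elim
        case (elim z)
        then have "integrable M (\<lambda>y. G z y)"
          unfolding G_def by (rule integrable_mult_left)
        then show ?case
          by (subst integrable_M_on_vanishing[OF S(1)]) (auto simp: G_def 0)
      qed
      then show "AE z in M_on T'. integrable (M_on S) (\<lambda>y. case_prod G (z, y))"
        unfolding AE_M_on[OF borel_sigma_compact[OF T']] by eventually_elim simp
    qed
    have "conv (conv f g) k x = (LINT z|M_on T'. conv f g z * k (- z + x))"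
      unfolding conv_def[of "conv f g"]
      by (rule integral_M_on_vanishing[OF T', symmetric]) (measurable, simp add: conv_def 0)
    also have "\<dots> = (LINT z|M_on T'. LINT y|M_on S. G z y)"
    proof (rule Bochner_Integration.integral_cong[OF refl])
      fix z
      have "conv f g z * k (- z + x) = (LINT y|M. G z y)"
        by (simp add: G_def conv_def)
      also have "\<dots> = (LINT y|M_on S. G z y)"
        by (rule integral_M_on_vanishing[OF S(1), symmetric]) (auto simp: G_def 0)
      finally show "conv f g z * k (- z + x) = (LINT y|M_on S. G z y)" .
    qed
    also have "\<dots> = (LINT y|M_on S. LINT z|M_on T'. G z y)"
      by (rule P.Fubini_integral[OF G_int, symmetric])
    also have "\<dots> = (LINT y|M_on S. f y * conv g k (- y + x))"
    proof (rule Bochner_Integration.integral_cong[OF refl])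
      fix y
      have "(LINT z|M_on T'. G z y) = (LINT z|M. G z y)"
        by (rule integral_M_on_vanishing[OF T']) (auto simp: G_def 0)
      also have "\<dots> = f y * (LINT z|M. g (- y + z) * k (- z + x))"
        by (simp add: G_def mult.assoc)
      \<comment> \<open>Left invariance under \<open>z \<mapsto> y + z\<close>, which turns
        \<open>- z + x\<close> into \<open>- z + (- y + x)\<close>.\<close>
      also have "(LINT z|M. g (- y + z) * k (- z + x)) = (LINT z|M. g (- y + (y + z)) * k (- (y + z) + x))"
        by (rule integral_translate[symmetric]) measurable
      also have "\<dots> = conv g k (- y + x)"
        unfolding conv_def by (simp add: minus_add add.assoc[symmetric] del: add_uminus_conv_diff)
      finally show "(LINT z|M_on T'. G z y) = f y * conv g k (- y + x)" .
    qed
    also have "\<dots> = conv f (conv g k) x"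
      unfolding conv_def[of f] using integrable_conv[OF g(1) k, THEN integrable_borel] S
      by (intro integral_M_on_vanishing) auto
    finally show ?case .
  qed
qed

lemma conv_assoc:
  assumes f: "integrable M f" and g: "integrable M g" and k: "integrable M k"
  shows "AE x in M. conv (conv f g) k x = conv f (conv g k) x"
proof -
  obtain f0 S where f0: "integrable M f0" "AE x in M. f x = f0 x" "sigma_compact S" "\<forall>x. x \<notin> S \<longrightarrow> f0 x = 0"
    using good_representative[OF f] by metis
  obtain g0 T where g0: "integrable M g0" "AE x in M. g x = g0 x" "sigma_compact T" "\<forall>x. x \<notin> T \<longrightarrow> g0 x = 0"
    "pair_measurable g0"
    using good_representative[OF g] by metis
  note meas = f[THEN integrable_borel] g[THEN integrable_borel] k[THEN integrable_borel]
    f0(1)[THEN integrable_borel] g0(1)[THEN integrable_borel]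
  have "conv f g = conv f0 g0"
    using f f0 g0 meas by (intro conv_cong_AE) auto
  moreover have "conv g k = conv g0 k"
    using g g0 meas by (intro conv_cong_AE) auto
  moreover have "conv f (conv g0 k) = conv f0 (conv g0 k)"
    using f f0 meas integrable_conv[OF g0(1) k, THEN integrable_borel] by (intro conv_cong_AE) auto
  ultimately show ?thesis
    using conv_assoc_good[OF f0(1,3,4) g0(1,5,3,4) k] by simp
qed

text \<open>Splitting \<open>x = y + (- y + x)\<close> gives
  \<open>norm (t x) \<le> norm (t y) * norm (t (- y + x))\<close>, so the weighted convolution is
  dominated by \<open>conv p q\<close>, to which the unweighted estimate applies.\<close>

lemma conv_weighted:
  fixes t :: "'a \<Rightarrow> complex"
  assumes f: "integrable M f" "integrable M (\<lambda>x. f x * t x)"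
    and g: "integrable M g" "integrable M (\<lambda>x. g x * t x)"
    and t [measurable]: "t \<in> borel_measurable borel"
    and sub: "submultiplicative t"
  shows integrable_conv_weighted: "integrable M (\<lambda>x. conv f g x * t x)"
    and norm_conv_weighted_le: "(LINT x|M. norm (conv f g x * t x))
      \<le> (LINT x|M. norm (f x * t x)) * (LINT x|M. norm (g x * t x))"
proof -
  define p q where "p = (\<lambda>x. complex_of_real (norm (f x * t x)))"
    and "q = (\<lambda>x. complex_of_real (norm (g x * t x)))"
  have pq: "integrable M p" "integrable M q"
    unfolding p_def q_def using f g by auto
  have [measurable]: "conv f g \<in> borel_measurable borel"
    using integrable_conv[OF f(1) g(1)] by (rule integrable_borel)
  have le: "AE x in M. norm (conv f g x * t x) \<le> norm (conv p q x)"
    using AE_integrable_conv[OF f(1) g(1)] AE_integrable_conv[OF pq]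
  proof eventually_elim
    case (elim x)
    have pq_norm: "norm (p y * q (- y + x)) = norm (f y * t y) * norm (g (- y + x) * t (- y + x))" for y
      by (simp add: p_def q_def norm_mult)
    have "norm (conv f g x * t x) \<le> (LINT y|M. norm (f y * g (- y + x))) * norm (t x)"
      unfolding conv_def norm_mult[of _ "t x"] by (intro mult_right_mono integral_norm_bound) auto
    also have "\<dots> = (LINT y|M. norm (f y * g (- y + x)) * norm (t x))"
      by simp
    also have "\<dots> \<le> (LINT y|M. norm (p y * q (- y + x)))"
    proof (rule integral_mono)
      show "integrable M (\<lambda>y. norm (f y * g (- y + x)) * norm (t x))"
        using elim by (intro integrable_mult_left integrable_norm)
      show "integrable M (\<lambda>y. norm (p y * q (- y + x)))"
        using elim by (intro integrable_norm)
      fix y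
      have "norm (t x) = norm (t (y + (- y + x)))" by (simp flip: add.assoc)
      also have "\<dots> \<le> norm (t y) * norm (t (- y + x))"
        using sub unfolding submultiplicative_def by blast
      finally have "norm (f y * g (- y + x)) * norm (t x) \<le>
          norm (f y * g (- y + x)) * (norm (t y) * norm (t (- y + x)))"
        by (rule mult_left_mono) simp
      then show "norm (f y * g (- y + x)) * norm (t x) \<le> norm (p y * q (- y + x))"
        unfolding pq_norm by (simp add: norm_mult mult_ac)
    qed
    also have "\<dots> = norm (conv p q x)"
    proof -
      have "conv p q x = complex_of_real (LINT y|M. norm (p y * q (- y + x)))"
        unfolding conv_def pq_norm by (simp add: p_def q_def flip: of_real_mult integral_complex_of_real)
      moreover have "0 \<le> (LINT y|M. norm (p y * q (- y + x)))" by simp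
      ultimately show ?thesis by simp
    qed
    finally show ?case .
  qed
  show int: "integrable M (\<lambda>x. conv f g x * t x)"
    by (rule Bochner_Integration.integrable_bound[OF integrable_conv[OF pq]]) (use le in auto)
  have "(LINT x|M. norm (conv f g x * t x)) \<le> (LINT x|M. norm (conv p q x))"
    using int integrable_conv[OF pq] le by (intro integral_mono_AE) auto
  also have "\<dots> \<le> (LINT x|M. norm (p x)) * (LINT x|M. norm (q x))"
    by (rule norm_conv_le[OF pq])
  also have "\<dots> = (LINT x|M. norm (f x * t x)) * (LINT x|M. norm (g x * t x))"
    by (simp add: p_def q_def)
  finally show "(LINT x|M. norm (conv f g x * t x))
      \<le> (LINT x|M. norm (f x * t x)) * (LINT x|M. norm (g x * t x))" .
qed

end

subsection \<open>The weighted algebra\<close>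

text \<open>Reduces the estimate for each power of \<tau> to that for a single weight.\<close>

lemma submultiplicative_power: "submultiplicative \<tau> \<Longrightarrow> submultiplicative (\<lambda>x. \<tau> x ^ k)"
  unfolding submultiplicative_def norm_power
  by (metis norm_ge_zero power_mono power_mult_distrib)

text \<open>Operations on classes are unions over representatives; the union collapses once all of
  them give the same class.\<close>

lemma UN_const_eq: "A \<noteq> {} \<Longrightarrow> (\<And>x. x \<in> A \<Longrightarrow> f x = c) \<Longrightarrow> (\<Union>x\<in>A. f x) = c"
  by auto

locale weighted_haar_group = haar_group +
  fixes \<tau> :: "'a \<Rightarrow> complex" and n :: nat
  assumes borel_tau [measurable]: "\<tau> \<in> borel_measurable borel"
    and submultiplicative_tau: "submultiplicative \<tau>"
begin

definition cl :: "('a \<Rightarrow> complex) \<Rightarrow> ('a \<Rightarrow> complex) set" where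
  "cl f = ae_eq M `` {f}"

text \<open>The range includes \<open>k = 0\<close>, so integrability of \<open>f\<close> itself is
  one of the conditions.\<close>

definition weighted :: "('a \<Rightarrow> complex) \<Rightarrow> bool" where
  "weighted f \<longleftrightarrow> (\<forall>k\<le>n. integrable M (\<lambda>x. f x * \<tau> x ^ k))"

definition wnorm :: "('a \<Rightarrow> complex) \<Rightarrow> real" where
  "wnorm f = (\<Sum>k\<le>n. LINT x|M. norm (f x * \<tau> x ^ k))"

lemma weighted_integrable: "weighted f \<Longrightarrow> integrable M f"
  unfolding weighted_def by (drule spec[of _ 0]) simp

lemma mem_cl: "g \<in> cl f \<longleftrightarrow> integrable M f \<and> integrable M g \<and> (AE x in M. f x = g x)"
  by (simp add: cl_def ae_eq_def)

lemma cl_eqI: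
  assumes "integrable M f" "integrable M g" "AE x in M. f x = g x"
  shows "cl f = cl g"
proof -
  have "(AE x in M. f x = h x) \<longleftrightarrow> (AE x in M. g x = h x)" for h
  proof
    assume "AE x in M. f x = h x"
    with assms(3) show "AE x in M. g x = h x" by eventually_elim simp
  next
    assume "AE x in M. g x = h x"
    with assms(3) show "AE x in M. f x = h x" by eventually_elim simp
  qed
  then show ?thesis using assms by (auto simp: mem_cl)
qed

lemma cl_eqD: "integrable M f \<Longrightarrow> integrable M g \<Longrightarrow> cl f = cl g \<Longrightarrow> AE x in M. f x = g x"
  using mem_cl[of g g] mem_cl[of g f] by simp

lemma weighted_cong:
  assumes "weighted f" "integrable M g" "AE x in M. f x = g x"
  shows "weighted g" "wnorm g = wnorm f"
proof -
  have [measurable]: "f \<in> borel_measurable borel" "g \<in> borel_measurable borel"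
    using assms weighted_integrable by (auto intro: integrable_borel)
  show "weighted g"
    unfolding weighted_def
  proof (intro allI impI)
    fix k assume "k \<le> n"
    then have "integrable M (\<lambda>x. f x * \<tau> x ^ k)"
      using assms(1) by (simp add: weighted_def)
    then show "integrable M (\<lambda>x. g x * \<tau> x ^ k)"
      by (rule integrable_cong_AE_imp) (use assms(3) in \<open>auto elim!: eventually_mono\<close>)
  qed
  show "wnorm g = wnorm f"
    unfolding wnorm_def
    by (intro sum.cong refl integral_cong_AE) (use assms(3) in \<open>auto elim!: eventually_mono\<close>)
qed

text \<open>\<open>L1_tau\<close> imposes its condition on all representatives; by
  \<open>weighted_cong\<close> it suffices to check one.\<close>

lemma L1_tau_eq: "L1_tau M \<tau> n = cl ` {f. weighted f}"
proof (intro equalityI subsetI)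
  fix F assume F: "F \<in> L1_tau M \<tau> n"
  then obtain f where f: "integrable M f" "F = cl f"
    unfolding L1_tau_def L1_def quotient_def cl_def by auto
  then have "f \<in> F" by (simp add: mem_cl)
  have "weighted f"
    unfolding weighted_def
  proof (intro allI impI)
    fix k assume "k \<le> n"
    then show "integrable M (\<lambda>x. f x * \<tau> x ^ k)"
      using F f \<open>f \<in> F\<close> by (cases "k = 0") (auto simp: L1_tau_def)
  qed
  with f show "F \<in> cl ` {f. weighted f}" by auto
next
  fix F assume "F \<in> cl ` {f. weighted f}"
  then obtain f where f: "weighted f" "F = cl f" by auto
  then have "F \<in> L1 M"
    unfolding L1_def cl_def by (auto intro: quotientI weighted_integrable)
  moreover have "integrable M (\<lambda>x. g x * \<tau> x ^ k)" if "g \<in> F" "k \<in> {1..n}" for g k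
    using weighted_cong(1)[OF f(1), of g] that by (auto simp: f(2) mem_cl weighted_def)
  ultimately show "F \<in> L1_tau M \<tau> n"
    unfolding L1_tau_def by blast
qed

section \<open>Operations and norm in terms of representatives\<close>

lemma L1_zero_eq: "L1_zero M = cl (\<lambda>x. 0)"
  by (simp add: L1_zero_def cl_def)

lemma L1_add_cl:
  assumes f: "integrable M f" and g: "integrable M g"
  shows "L1_add M (cl f) (cl g) = cl (\<lambda>x. f x + g x)"
proof -
  have ne: "cl f \<noteq> {}" "cl g \<noteq> {}"
    using mem_cl[of f f] mem_cl[of g g] f g by auto
  have "cl (\<lambda>x. f' x + g' x) = cl (\<lambda>x. f x + g x)" if f': "f' \<in> cl f" and g': "g' \<in> cl g" for f' g'
  proof (rule cl_eqI)
    have "AE x in M. f x = f' x" "AE x in M. g x = g' x"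
      using f' g' by (simp_all add: mem_cl)
    then show "AE x in M. f' x + g' x = f x + g x"
      by eventually_elim simp
  qed (use f' g' in \<open>simp_all add: mem_cl\<close>)
  then show ?thesis
    unfolding L1_add_def cl_def[symmetric] by (intro UN_const_eq ne)
qed

lemma L1_scale_cl:
  assumes f: "integrable M f"
  shows "L1_scale M c (cl f) = cl (\<lambda>x. c * f x)"
proof -
  have ne: "cl f \<noteq> {}"
    using mem_cl[of f f] f by auto
  have "cl (\<lambda>x. c * f' x) = cl (\<lambda>x. c * f x)" if f': "f' \<in> cl f" for f'
  proof (rule cl_eqI)
    have "AE x in M. f x = f' x"
      using f' by (simp add: mem_cl)
    then show "AE x in M. c * f' x = c * f x"
      by eventually_elim simp
  qed (use f' in \<open>simp_all add: mem_cl\<close>)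
  then show ?thesis
    unfolding L1_scale_def cl_def[symmetric] by (intro UN_const_eq ne)
qed

text \<open>\<open>conv\<close> is the same function for all representatives, so the functions
  \<open>h\<close> collected by \<open>L1_convolution\<close> form a single class.\<close>

lemma L1_convolution_cl:
  assumes f: "integrable M f" and g: "integrable M g"
  shows "L1_convolution M (cl f) (cl g) = cl (conv f g)"
proof (intro equalityI subsetI)
  fix h assume "h \<in> L1_convolution M (cl f) (cl g)"
  then obtain f' g' where h: "integrable M h" "f' \<in> cl f" "g' \<in> cl g" "is_convolution M f' g' h"
    unfolding L1_convolution_def by auto
  then have f'g': "integrable M f'" "integrable M g'" "AE x in M. f x = f' x" "AE x in M. g x = g' x"
    by (simp_all add: mem_cl)
  have "conv f g = conv f' g'"
    by (intro conv_cong_AE f f'g' g integrable_borel)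
  then show "h \<in> cl (conv f g)"
    using h(1,4) f g f'g' by (simp add: mem_cl integrable_conv is_convolution_iff eq_commute)
next
  fix h assume "h \<in> cl (conv f g)"
  then have "integrable M h" "is_convolution M f g h"
    using f g by (simp_all add: mem_cl is_convolution_iff eq_commute)
  moreover have "f \<in> cl f" "g \<in> cl g"
    using f g by (simp_all add: mem_cl)
  ultimately show "h \<in> L1_convolution M (cl f) (cl g)"
    unfolding L1_convolution_def by blast
qed

lemma norm_tau_cl:
  assumes "weighted f"
  shows "norm_tau M \<tau> n (cl f) = wnorm f"
proof -
  have "(\<lambda>f. \<Sum>k\<le>n. LINT x|M. norm (f x * \<tau> x ^ k)) ` cl f = {wnorm f}"
  proof (intro equalityI subsetI)
    fix r assume "r \<in> (\<lambda>f. \<Sum>k\<le>n. LINT x|M. norm (f x * \<tau> x ^ k)) ` cl f"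
    then obtain g where "g \<in> cl f" "r = wnorm g"
      by (auto simp: wnorm_def)
    then show "r \<in> {wnorm f}"
      using weighted_cong(2)[OF assms, of g] by (simp add: mem_cl)
  next
    fix r assume "r \<in> {wnorm f}"
    moreover have "f \<in> cl f" using weighted_integrable[OF assms] by (simp add: mem_cl)
    ultimately show "r \<in> (\<lambda>f. \<Sum>k\<le>n. LINT x|M. norm (f x * \<tau> x ^ k)) ` cl f"
      by (auto simp: wnorm_def)
  qed
  then show ?thesis
    unfolding norm_tau_def by simp
qed

section \<open>The weighted norm on functions\<close>

lemma weightedD: "weighted f \<Longrightarrow> k \<le> n \<Longrightarrow> integrable M (\<lambda>x. f x * \<tau> x ^ k)"
  by (simp add: weighted_def)

lemma weighted_zero: "weighted (\<lambda>x. 0)"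
  by (simp add: weighted_def)

lemma weighted_add: "weighted f \<Longrightarrow> weighted g \<Longrightarrow> weighted (\<lambda>x. f x + g x)"
  by (simp add: weighted_def distrib_right)

lemma weighted_scale: "weighted f \<Longrightarrow> weighted (\<lambda>x. c * f x)"
  by (simp add: weighted_def mult.assoc)

lemma weighted_diff: "weighted f \<Longrightarrow> weighted g \<Longrightarrow> weighted (\<lambda>x. f x - g x)"
  using weighted_add[OF _ weighted_scale[of g "- 1"], of f] by simp

lemma weighted_conv: "weighted f \<Longrightarrow> weighted g \<Longrightarrow> weighted (conv f g)"
  unfolding weighted_def[of "conv f g"]
  by (intro allI impI integrable_conv_weighted submultiplicative_power submultiplicative_tau weighted_integrable
      weightedD) measurable

lemma wnorm_nonneg: "0 \<le> wnorm f"
  by (simp add: wnorm_def sum_nonneg)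

lemma integral_le_wnorm: "k \<le> n \<Longrightarrow> (LINT x|M. norm (f x * \<tau> x ^ k)) \<le> wnorm f"
  unfolding wnorm_def by (rule member_le_sum[of k "{..n}" "\<lambda>k. LINT x|M. norm (f x * \<tau> x ^ k)"]) auto

text \<open>The term \<open>k = 0\<close> is the unweighted norm and already separates
  classes.\<close>

lemma wnorm_eq_0_iff:
  assumes "weighted f"
  shows "wnorm f = 0 \<longleftrightarrow> (AE x in M. f x = 0)"
proof
  assume "wnorm f = 0"
  then have "(LINT x|M. norm (f x)) \<le> 0"
    using integral_le_wnorm[of 0 f] by simp
  then have "(LINT x|M. norm (f x)) = 0"
    by (simp add: order_antisym)
  then show "AE x in M. f x = 0"
    using weighted_integrable[OF assms] by (subst (asm) integral_nonneg_eq_0_iff_AE) auto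
next
  assume "AE x in M. f x = 0"
  then have "wnorm f = wnorm (\<lambda>x. 0)"
    by (intro weighted_cong(2)[OF weighted_zero weighted_integrable[OF assms]]) (auto elim!: eventually_mono)
  then show "wnorm f = 0" by (simp add: wnorm_def)
qed

lemma wnorm_scale: "wnorm (\<lambda>x. c * f x) = norm c * wnorm f"
  by (simp add: wnorm_def norm_mult mult.assoc sum_distrib_left)

lemma wnorm_triangle:
  assumes "weighted f" "weighted g"
  shows "wnorm (\<lambda>x. f x + g x) \<le> wnorm f + wnorm g"
  unfolding wnorm_def sum.distrib[symmetric]
proof (rule sum_mono)
  fix k assume "k \<in> {..n}"
  then have i: "integrable M (\<lambda>x. f x * \<tau> x ^ k)" "integrable M (\<lambda>x. g x * \<tau> x ^ k)"
    using assms by (simp_all add: weighted_def)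
  have "(LINT x|M. norm ((f x + g x) * \<tau> x ^ k)) \<le> (LINT x|M. norm (f x * \<tau> x ^ k) + norm (g x * \<tau> x ^ k))"
    using i by (intro integral_mono') (auto simp: distrib_right intro: norm_triangle_ineq)
  then show "(LINT x|M. norm ((f x + g x) * \<tau> x ^ k)) \<le>
      (LINT x|M. norm (f x * \<tau> x ^ k)) + (LINT x|M. norm (g x * \<tau> x ^ k))"
    using i by simp
qed

lemma wnorm_conv_le:
  assumes "weighted f" "weighted g"
  shows "wnorm (conv f g) \<le> wnorm f * wnorm g"
proof -
  have "wnorm (conv f g) \<le>
      (\<Sum>k\<le>n. (LINT x|M. norm (f x * \<tau> x ^ k)) * (LINT x|M. norm (g x * \<tau> x ^ k)))"
    unfolding wnorm_def using assms
    by (intro sum_mono norm_conv_weighted_le submultiplicative_power submultiplicative_tau weighted_integrable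
        weightedD) auto
  \<comment> \<open>Only diagonal products occur, so each second factor may be enlarged to the whole
    sum \<open>wnorm g\<close>.\<close>
  also have "\<dots> \<le> (\<Sum>k\<le>n. (LINT x|M. norm (f x * \<tau> x ^ k)) * wnorm g)"
    by (intro sum_mono mult_left_mono integral_le_wnorm) auto
  also have "\<dots> = wnorm f * wnorm g"
    unfolding wnorm_def[of f] by (simp add: sum_distrib_right)
  finally show ?thesis .
qed

text \<open>The term \<open>k = 0\<close> yields a subsequence that converges almost everywhere. Its
  limit \<open>g\<close> does not depend on \<open>k\<close>, and Fatou carries the Cauchy bound
  over to \<open>g\<close> for all \<open>k \<le> n\<close> at once.\<close>

lemma wnorm_complete:
  assumes f: "\<And>i. weighted (f i)"
    and cauchy: "\<And>e. 0 < e \<Longrightarrow> \<exists>N. \<forall>i\<ge>N. \<forall>j\<ge>N. wnorm (\<lambda>x. f i x - f j x) < e"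
  shows "\<exists>g. weighted g \<and> (\<lambda>i. wnorm (\<lambda>x. f i x - g x)) \<longlonglongrightarrow> 0"
proof -
  have int: "integrable M (f i)" for i
    by (rule weighted_integrable) (rule f)
  have [measurable]: "f i \<in> borel_measurable borel" for i
    by (rule integrable_borel) (rule int)
  obtain r where r: "strict_mono r" "AE x in M. Cauchy (\<lambda>i. f (r i) x)"
  proof (rule cauchy_L1_AE_cauchy_subseq[of M f])
    fix e :: real assume "0 < e"
    from cauchy[OF this] obtain N where N: "\<And>i j. i \<ge> N \<Longrightarrow> j \<ge> N \<Longrightarrow> wnorm (\<lambda>x. f i x - f j x) < e"
      by blast
    have "(LINT x|M. norm (f i x - f j x)) < e" if "i \<ge> N" "j \<ge> N" for i j
      using integral_le_wnorm[of 0 "\<lambda>x. f i x - f j x"] N[OF that] by simp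
    then show "\<exists>N. \<forall>i\<ge>N. \<forall>j\<ge>N. (LINT x|M. norm (f i x - f j x)) < e" by blast
  qed (use int in auto)
  define g where "g x = lim (\<lambda>i. f (r i) x)" for x
  have [measurable]: "g \<in> borel_measurable borel"
    unfolding g_def by measurable
  have g: "AE x in M. (\<lambda>i. f (r i) x) \<longlonglongrightarrow> g x"
    using r(2) by eventually_elim (simp add: g_def convergent_LIMSEQ_iff[symmetric] Cauchy_convergent)
  \<comment> \<open>Stated with \<open>\<integral>\<^sup>+\<close> because integrability of the
    weighted difference with \<open>g\<close> is unknown here; this finite bound is what proves
    it.\<close>
  have bound: "\<exists>N. \<forall>i\<ge>N. \<forall>k\<le>n. (\<integral>\<^sup>+x. norm ((f i x - g x) * \<tau> x ^ k) \<partial>M) \<le> ennreal e" if "0 < e" for e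
  proof -
    from cauchy[OF that] obtain N where N: "\<And>i j. i \<ge> N \<Longrightarrow> j \<ge> N \<Longrightarrow> wnorm (\<lambda>x. f i x - f j x) < e"
      by blast
    have "(\<integral>\<^sup>+x. norm ((f i x - g x) * \<tau> x ^ k) \<partial>M) \<le> ennreal e" if "i \<ge> N" "k \<le> n" for i k
    proof -
      have "AE x in M. ennreal (norm ((f i x - g x) * \<tau> x ^ k)) =
          liminf (\<lambda>j. ennreal (norm ((f i x - f (r j) x) * \<tau> x ^ k)))"
        using g
      proof eventually_elim
        case (elim x)
        then have "(\<lambda>j. ennreal (norm ((f i x - f (r j) x) * \<tau> x ^ k))) \<longlonglongrightarrow> ennreal (norm ((f i x - g x) * \<tau> x ^ k))"
          by (intro tendsto_intros tendsto_ennrealI)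
        then show ?case by (intro lim_imp_Liminf[symmetric]) auto
      qed
      then have "(\<integral>\<^sup>+x. norm ((f i x - g x) * \<tau> x ^ k) \<partial>M) =
          (\<integral>\<^sup>+x. liminf (\<lambda>j. ennreal (norm ((f i x - f (r j) x) * \<tau> x ^ k))) \<partial>M)"
        by (rule nn_integral_cong_AE)
      also have "\<dots> \<le> liminf (\<lambda>j. \<integral>\<^sup>+x. norm ((f i x - f (r j) x) * \<tau> x ^ k) \<partial>M)"
        by (rule nn_integral_liminf) measurable
      also have "\<dots> \<le> liminf (\<lambda>j. ennreal e)"
      proof (rule Liminf_mono, rule eventually_sequentiallyI)
        fix j assume "N \<le> j"
        then have "N \<le> r j" using seq_suble[OF r(1), of j] by simp
        have "(\<integral>\<^sup>+x. norm ((f i x - f (r j) x) * \<tau> x ^ k) \<partial>M) = ennreal (LINT x|M. norm ((f i x - f (r j) x) * \<tau> x ^ k))"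
          using weighted_diff[OF f[of i] f[of "r j"]] \<open>k \<le> n\<close>
          by (intro nn_integral_eq_integral integrable_norm) (auto simp: weighted_def)
        also have "\<dots> \<le> ennreal e"
          using integral_le_wnorm[OF \<open>k \<le> n\<close>, of "\<lambda>x. f i x - f (r j) x"] N[OF \<open>i \<ge> N\<close> \<open>N \<le> r j\<close>]
          by (intro ennreal_leI) simp
        finally show "(\<integral>\<^sup>+x. norm ((f i x - f (r j) x) * \<tau> x ^ k) \<partial>M) \<le> ennreal e" .
      qed
      also have "\<dots> = ennreal e"
        by (rule Liminf_const) simp
      finally show ?thesis .
    qed
    then show ?thesis by blast
  qed
  have diff: "weighted (\<lambda>x. f i x - g x)"
    if "\<forall>k\<le>n. (\<integral>\<^sup>+x. norm ((f i x - g x) * \<tau> x ^ k) \<partial>M) \<le> ennreal e" for i e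
    unfolding weighted_def
  proof (intro allI impI integrableI_bounded)
    fix k assume "k \<le> n"
    then show "(\<integral>\<^sup>+x. norm ((f i x - g x) * \<tau> x ^ k) \<partial>M) < \<infinity>"
      using that by (auto intro: le_less_trans)
  qed simp
  have g_weighted: "weighted g"
  proof -
    obtain N where "\<forall>i\<ge>N. \<forall>k\<le>n. (\<integral>\<^sup>+x. norm ((f i x - g x) * \<tau> x ^ k) \<partial>M) \<le> ennreal 1"
      using bound[of 1] by auto
    then have "weighted (\<lambda>x. f N x - g x)"
      by (intro diff[of N 1]) auto
    \<comment> \<open>\<open>g\<close> is \<open>f N\<close> minus the difference
      \<open>f N - g\<close>.\<close>
    from weighted_diff[OF f[of N] this] show ?thesis by simp
  qed
  have "(\<lambda>i. wnorm (\<lambda>x. f i x - g x)) \<longlonglongrightarrow> 0"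
  proof (rule LIMSEQ_I)
    fix e :: real assume "0 < e"
    \<comment> \<open>The \<open>n + 1\<close> terms add up to \<open>e / 2\<close>; the bound on
      each is not strict, and the factor 2 restores strictness.\<close>
    define d where "d = e / (2 * real (Suc n))"
    have d: "0 < d" using \<open>0 < e\<close> by (simp add: d_def)
    obtain N where N: "\<forall>i\<ge>N. \<forall>k\<le>n. (\<integral>\<^sup>+x. norm ((f i x - g x) * \<tau> x ^ k) \<partial>M) \<le> ennreal d"
      using bound[OF d] by auto
    have "norm (wnorm (\<lambda>x. f i x - g x) - 0) < e" if "i \<ge> N" for i
    proof -
      have w: "weighted (\<lambda>x. f i x - g x)"
        by (intro weighted_diff f g_weighted)
      have "wnorm (\<lambda>x. f i x - g x) \<le> (\<Sum>k\<le>n. d)"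
        unfolding wnorm_def
      proof (rule sum_mono)
        fix k assume k: "k \<in> {..n}"
        then have "ennreal (LINT x|M. norm ((f i x - g x) * \<tau> x ^ k)) = (\<integral>\<^sup>+x. norm ((f i x - g x) * \<tau> x ^ k) \<partial>M)"
          using w by (intro nn_integral_eq_integral[symmetric] integrable_norm) (auto simp: weighted_def)
        also have "\<dots> \<le> ennreal d"
          using N that k by simp
        finally show "(LINT x|M. norm ((f i x - g x) * \<tau> x ^ k)) \<le> d"
          using d by (subst (asm) ennreal_le_iff) auto
      qed
      also have "\<dots> = e / 2"
        by (simp add: d_def field_simps)
      also have "\<dots> < e" using \<open>0 < e\<close> by simp
      finally show ?thesis using wnorm_nonneg[of "\<lambda>x. f i x - g x"] by simp
    qed
    then show "\<exists>N. \<forall>i\<ge>N. norm (wnorm (\<lambda>x. f i x - g x) - 0) < e" by blast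
  qed
  with g_weighted show ?thesis by blast
qed

end

section \<open>The Banach algebra axioms\<close>

theorem proposition4p2:
  fixes M :: "'a::{topological_group_add, t2_space} measure"
    and \<tau> :: "'a \<Rightarrow> complex"
    and n :: nat
  assumes "locally_compact_space (euclidean :: 'a topology)"
    and "left_haar_measure M"
    and "\<forall>x. \<tau> x \<noteq> 0"
    and "\<tau> \<in> borel_measurable borel"
    and "submultiplicative \<tau>"
  shows "complex_banach_algebra_on (L1_tau M \<tau> n)
           (L1_zero M) (L1_add M) (L1_scale M) (L1_convolution M) (norm_tau M \<tau> n)"
proof -
  interpret weighted_haar_group M \<tau> n
    by unfold_locales fact+
  note int = weighted_integrable
  \<comment> \<open>These rules move every operation from classes to representatives, so each axiom
    becomes a statement about functions.\<close>
  note ops = L1_add_cl L1_scale_cl L1_convolution_cl norm_tau_cl L1_zero_eq int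
    weighted_zero weighted_add weighted_scale weighted_conv
  have rep: "\<exists>f. weighted f \<and> F = cl f" if "F \<in> L1_tau M \<tau> n" for F
    using that by (auto simp: L1_tau_eq)
  have mem: "cl f \<in> L1_tau M \<tau> n" if "weighted f" for f
    using that by (simp add: L1_tau_eq)
  show ?thesis
  proof
    show "L1_zero M \<in> L1_tau M \<tau> n"
      by (simp add: ops mem)
  next
    fix x assume "x \<in> L1_tau M \<tau> n"
    then obtain f where f: "weighted f" "x = cl f" using rep by blast
    show "L1_add M (L1_zero M) x = x"
      using f by (simp add: ops)
    show "\<exists>y\<in>L1_tau M \<tau> n. L1_add M x y = L1_zero M"
      using f mem[OF weighted_scale[of f "- 1"]] by (intro bexI[of _ "cl (\<lambda>x. - 1 * f x)"]) (simp_all add: ops)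
    show "L1_scale M 1 x = x"
      using f by (simp add: ops)
    show "0 \<le> norm_tau M \<tau> n x"
      using f by (simp add: ops wnorm_nonneg)
    show "norm_tau M \<tau> n x = 0 \<longleftrightarrow> x = L1_zero M"
    proof -
      have "cl f = cl (\<lambda>x. 0) \<longleftrightarrow> (AE x in M. f x = 0)"
        using cl_eqI[of f "\<lambda>x. 0"] cl_eqD[of f "\<lambda>x. 0"] int[OF f(1)] by auto
      then show ?thesis using f by (simp add: ops wnorm_eq_0_iff)
    qed
    fix c
    show "L1_scale M c x \<in> L1_tau M \<tau> n"
      using f by (simp add: ops mem)
    show "norm_tau M \<tau> n (L1_scale M c x) = norm c * norm_tau M \<tau> n x"
      using f by (simp add: ops wnorm_scale)
    fix d
    show "L1_scale M (c + d) x = L1_add M (L1_scale M c x) (L1_scale M d x)"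
      using f by (simp add: ops distrib_right)
    show "L1_scale M c (L1_scale M d x) = L1_scale M (c * d) x"
      using f by (simp add: ops mult.assoc)
  next
    fix x y assume "x \<in> L1_tau M \<tau> n" "y \<in> L1_tau M \<tau> n"
    then obtain f g where f: "weighted f" "x = cl f" and g: "weighted g" "y = cl g" using rep by metis
    show "L1_add M x y \<in> L1_tau M \<tau> n" "L1_convolution M x y \<in> L1_tau M \<tau> n"
      using f g by (simp_all add: ops mem)
    show "L1_add M x y = L1_add M y x"
      using f g by (simp add: ops add.commute)
    show "norm_tau M \<tau> n (L1_add M x y) \<le> norm_tau M \<tau> n x + norm_tau M \<tau> n y"
      using f g by (simp add: ops wnorm_triangle)
    show "norm_tau M \<tau> n (L1_convolution M x y) \<le> norm_tau M \<tau> n x * norm_tau M \<tau> n y"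
      using f g by (simp add: ops wnorm_conv_le)
    fix c
    show "L1_scale M c (L1_add M x y) = L1_add M (L1_scale M c x) (L1_scale M c y)"
      using f g by (simp add: ops distrib_left)
    have scale_left: "conv (\<lambda>x. c * f x) g = (\<lambda>x. c * conv f g x)"
      and scale_right: "conv f (\<lambda>x. c * g x) = (\<lambda>x. c * conv f g x)"
      by (auto simp: conv_scale_left conv_scale_right)
    show "L1_convolution M (L1_scale M c x) y = L1_scale M c (L1_convolution M x y)"
      "L1_convolution M x (L1_scale M c y) = L1_scale M c (L1_convolution M x y)"
      using f g by (simp_all add: ops scale_left scale_right)
  next
    fix x y z assume "x \<in> L1_tau M \<tau> n" "y \<in> L1_tau M \<tau> n" "z \<in> L1_tau M \<tau> n"
    then obtain f g k where f: "weighted f" "x = cl f" and g: "weighted g" "y = cl g"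
      and k: "weighted k" "z = cl k" using rep by metis
    show "L1_add M (L1_add M x y) z = L1_add M x (L1_add M y z)"
      using f g k by (simp add: ops add.assoc)
    \<comment> \<open>The functions agree only almost everywhere, which is equality of classes; the
      same holds for the distributive laws.\<close>
    have "cl (conv (conv f g) k) = cl (conv f (conv g k))"
      using f(1) g(1) k(1) by (intro cl_eqI conv_assoc) (simp_all add: ops)
    then show "L1_convolution M (L1_convolution M x y) z = L1_convolution M x (L1_convolution M y z)"
      using f g k by (simp add: ops)
    have "cl (conv (\<lambda>x. f x + g x) k) = cl (\<lambda>x. conv f k x + conv g k x)"
      using f(1) g(1) k(1) by (intro cl_eqI conv_add_left) (simp_all add: ops)
    then show "L1_convolution M (L1_add M x y) z = L1_add M (L1_convolution M x z) (L1_convolution M y z)"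
      using f g k by (simp add: ops)
    have "cl (conv f (\<lambda>x. g x + k x)) = cl (\<lambda>x. conv f g x + conv f k x)"
      using f(1) g(1) k(1) by (intro cl_eqI conv_add_right) (simp_all add: ops)
    then show "L1_convolution M x (L1_add M y z) = L1_add M (L1_convolution M x y) (L1_convolution M x z)"
      using f g k by (simp add: ops)
  next
    fix X :: "nat \<Rightarrow> ('a \<Rightarrow> complex) set"
    assume X: "\<And>i. X i \<in> L1_tau M \<tau> n"
      and cauchy: "\<And>e. 0 < e \<Longrightarrow> \<exists>N. \<forall>i\<ge>N. \<forall>j\<ge>N.
        norm_tau M \<tau> n (L1_add M (X i) (L1_scale M (- 1) (X j))) < e"
    have "\<forall>i. \<exists>f. weighted f \<and> X i = cl f"
      using X rep by blast
    then obtain f where "\<forall>i. weighted (f i) \<and> X i = cl (f i)"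
      by (rule choice[THEN exE])
    then have f: "weighted (f i)" "X i = cl (f i)" for i
      by simp_all
    \<comment> \<open>The difference of classes, written with the scalar \<open>- 1\<close>, is the
      class of the pointwise difference.\<close>
    have diff: "norm_tau M \<tau> n (L1_add M (cl p) (L1_scale M (- 1) (cl q))) = wnorm (\<lambda>x. p x - q x)"
      if "weighted p" "weighted q" for p q
      using that weighted_scale[OF that(2), of "- 1"] weighted_diff[OF that]
      by (simp add: ops del: mult_minus1)
    have "\<exists>g. weighted g \<and> (\<lambda>i. wnorm (\<lambda>x. f i x - g x)) \<longlonglongrightarrow> 0"
      by (rule wnorm_complete) (use cauchy f in \<open>simp_all add: diff\<close>)
    then obtain g where "weighted g" "(\<lambda>i. wnorm (\<lambda>x. f i x - g x)) \<longlonglongrightarrow> 0"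
      by blast
    then show "\<exists>x\<in>L1_tau M \<tau> n. (\<lambda>i. norm_tau M \<tau> n (L1_add M (X i) (L1_scale M (- 1) x))) \<longlonglongrightarrow> 0"
      using f by (intro bexI[of _ "cl g"] mem) (simp_all add: diff)
  qed
qed

end
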